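(* Let $G=A\ast_C B$, and suppose that the Membership Search Problem and the Coset Representative Search Problem are decidable in $A$ and in $B$ for the subgroup $C$. Then Algorithm II (described in the context) finds the normal form of $g$ for every given element $g\in G$.
   Context: $A=\langle X\mid R_A\rangle$, $B=\langle Y\mid R_B\rangle$ are groups given by finite presentations; $C$ is generated by $z_1,\dots,z_n$ and embedded in $A$ and $B$ by monomorphisms $\phi,\psi$; $u_i=z_i^\phi$ is a word in $X$, $v_i=z_i^\psi$ a word in $Y$; $G=\langle X\cup Y\mid R_A,R_B,\ u_i=v_i\rangle$; $A,B$ are identified with subgroups of $G$, $C=A\cap B$. Elements of $G$ are given as words in $X\cup Y$. $S$ and $T$ are recursive sets of right coset representatives of $C$ in $A$ and in $B$, with $1$ representing $C$. The normal form of $g\in G$ with respect to $S,T$ is the unique expression $g=cp_1\cdots p_m$ with $c\in C$, $p_i\in(S\cup T)\smallsetminus\{1\}$ and consecutive $p_i$ in different factors. Membership Search Problem for $C$: given a word $w$, decide whether $w\in C$ and, if so, write it as a product of the given generators of $C$. Coset Representative Search Problem for $C$ (relative to $S$, $T$): given $w$, find the representative of $Cw$ in $S$ (respectively $T$). Algorithm II. Input: a word $g=g_1\cdots g_k$ with $g_i$ reduced words alternately in $X$ and $Y$. Step 1 (applied to a product $g_1\cdots g_i$). If $g_i$ is a word in $X$, write $g_i=c\,p$ with $p\in S$ and $c\in C$ given as a word $c(u_1,\dots,u_n)$ (using the decision algorithms for the two problems); rewrite $c(u_1,\dots,u_n)$ as $c(v_1,\dots,v_n)$ by substituting $v_j$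 for $u_j$; replace $g_{i-1}$ by $g_{i-1}'=g_{i-1}c(v_1,\dots,v_n)$; keep $p$ as last syllable if $p\neq1$, delete it if $p=1$. If $g_i$ is a word in $Y$, do the same with $T$ in place of $S$ and the $u_j$ and $v_j$ exchanged. Start by applying Step 1 to $g_1\cdots g_k$, repeating it as long as the last syllable gets deleted. Step 2. When the word has the form $g_1\cdots g_i\,p_{i+1}\cdots p_m$ with $p_{i+1}\cdots p_m$ in normal form, apply Step 1 to $g_1\cdots g_i$. If this produces $p_i\neq1$ and $p_i,p_{i+1}$ lie in the same factor, write $p_ip_{i+1}=c'p_i'$ with $c'\in C$ and $p_i'\in S$ (respectively $T$), multiply $g_{i-1}'$ on the right by $c'$ (written in the generators of $C$ in the other factor), and keep $p_i'$ if $p_i'\neq1$, deleting it otherwise. Continue with Step 2 until a normal form $c_1p_1\cdots p_m$ is reached; output it. (When no syllable $g_{i-1}$ remains, the elements of $C$ are collected in the leading coefficient $c_1$.) *)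

theory Defs
  imports
    "HOL-Algebra.Generated_Groups"
    "HOL-Library.Nat_Bijection"
    "HOL-Library.Countable_Set"
    "HOL-Library.While_Combinator"
begin

section \<open>Recursive functions\<close>

text \<open>
  The total recursive functions of one argument, several arguments being passed through the
  Cantor pairing \<^const>\<open>prod_encode\<close>. Minimization is applied to regular functions only, which
  by Kleene's normal form theorem still yields all total recursive functions.
\<close>

inductive recursive_fn :: "(nat \<Rightarrow> nat) \<Rightarrow> bool" where
  zero: "recursive_fn (\<lambda>_. 0)"
| succ: "recursive_fn Suc"
| left: "recursive_fn (\<lambda>a. fst (prod_decode a))"
| right: "recursive_fn (\<lambda>a. snd (prod_decode a))"
| pair: "recursive_fn f \<Longrightarrow> recursive_fn g \<Longrightarrow> recursive_fn (\<lambda>a. prod_encode (f a, g a))"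
| comp: "recursive_fn f \<Longrightarrow> recursive_fn g \<Longrightarrow> recursive_fn (\<lambda>a. f (g a))"
| prec: "recursive_fn f \<Longrightarrow> recursive_fn g \<Longrightarrow>
    recursive_fn (\<lambda>a. rec_nat (f (fst (prod_decode a)))
      (\<lambda>k r. g (prod_encode (fst (prod_decode a), prod_encode (k, r)))) (snd (prod_decode a)))"
| mini: "recursive_fn f \<Longrightarrow> \<forall>a. \<exists>k. f (prod_encode (a, k)) = 0 \<Longrightarrow>
    recursive_fn (\<lambda>a. LEAST k. f (prod_encode (a, k)) = 0)"

definition computable_on :: "'a set \<Rightarrow> ('a \<Rightarrow> nat) \<Rightarrow> ('b \<Rightarrow> nat) \<Rightarrow> ('a \<Rightarrow> 'b) \<Rightarrow> bool" where
  "computable_on D enc_in enc_out h \<longleftrightarrow>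
     (\<exists>f. recursive_fn f \<and> (\<forall>w\<in>D. f (enc_in w) = enc_out (h w)))"

definition recursive_subset :: "'a set \<Rightarrow> ('a \<Rightarrow> nat) \<Rightarrow> 'a set \<Rightarrow> bool" where
  "recursive_subset D enc P \<longleftrightarrow> P \<subseteq> D \<and> computable_on D enc of_bool (\<lambda>w. w \<in> P)"


section \<open>Words and presented groups\<close>

text \<open>The letter \<open>(x, True)\<close> stands for \<open>x\<close> and \<open>(x, False)\<close> for its inverse.\<close>

type_synonym 'x word = "('x \<times> bool) list"

definition words :: "'x set \<Rightarrow> 'x word set" where
  "words X = lists (X \<times> UNIV)"

definition inv_word :: "'x word \<Rightarrow> 'x word" where
  "inv_word w = rev (map (\<lambda>(x, e). (x, \<not> e)) w)"

definition reduced :: "'x word \<Rightarrow> bool" where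
  "reduced w \<longleftrightarrow> successively (\<lambda>(x, e) (y, d). \<not> (x = y \<and> e \<noteq> d)) w"

text \<open>\<open>subst_word u c\<close> is the word \<open>c(u\<^sub>1, \<dots>, u\<^sub>n)\<close>.\<close>

definition subst_word :: "('z \<Rightarrow> 'x word) \<Rightarrow> 'z word \<Rightarrow> 'x word" where
  "subst_word u c = concat (map (\<lambda>(i, e). if e then u i else inv_word (u i)) c)"

inductive pres_eq :: "'x set \<Rightarrow> 'x word set \<Rightarrow> 'x word \<Rightarrow> 'x word \<Rightarrow> bool" for X R where
  refl: "w \<in> words X \<Longrightarrow> pres_eq X R w w"
| sym: "pres_eq X R w w' \<Longrightarrow> pres_eq X R w' w"
| trans: "pres_eq X R w w' \<Longrightarrow> pres_eq X R w' w'' \<Longrightarrow> pres_eq X R w w''"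
| cancel: "a \<in> words X \<Longrightarrow> b \<in> words X \<Longrightarrow> x \<in> X \<Longrightarrow>
    pres_eq X R (a @ [(x, e), (x, \<not> e)] @ b) (a @ b)"
| relator: "a \<in> words X \<Longrightarrow> b \<in> words X \<Longrightarrow> r \<in> R \<Longrightarrow> pres_eq X R (a @ r @ b) (a @ b)"

definition pres_class :: "'x set \<Rightarrow> 'x word set \<Rightarrow> 'x word \<Rightarrow> 'x word set" where
  "pres_class X R w = {w'. pres_eq X R w w'}"

definition presented_group :: "'x set \<Rightarrow> 'x word set \<Rightarrow> 'x word set monoid" where
  "presented_group X R =
     \<lparr>carrier = pres_class X R ` words X,
      mult = (\<lambda>P Q. \<Union>p\<in>P. \<Union>q\<in>Q. pres_class X R (p @ q)),
      one = pres_class X R []\<rparr>"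

text \<open>
  Words are coded through a numbering of the generators. The generating sets in use are finite,
  so computability does not depend on the numbering.
\<close>

definition word_code :: "'x set \<Rightarrow> 'x word \<Rightarrow> nat" where
  "word_code X w = list_encode (map (\<lambda>(x, e). prod_encode (to_nat_on X x, of_bool e)) w)"

fun option_code :: "('a \<Rightarrow> nat) \<Rightarrow> 'a option \<Rightarrow> nat" where
  "option_code enc None = 0"
| "option_code enc (Some a) = Suc (enc a)"


section \<open>The amalgamated product and normal forms\<close>

definition amalgam_relators ::
  "'x word set \<Rightarrow> 'y word set \<Rightarrow> nat \<Rightarrow> (nat \<Rightarrow> 'x word) \<Rightarrow> (nat \<Rightarrow> 'y word) \<Rightarrow> ('x + 'y) word set"
where
  "amalgam_relators RA RB n u v =
     map (apfst Inl) ` RA \<union> map (apfst Inr) ` RB \<union>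
     (\<lambda>i. map (apfst Inl) (u i) @ inv_word (map (apfst Inr) (v i))) ` {..<n}"

definition amalgam_class ::
  "'x set \<Rightarrow> 'x word set \<Rightarrow> 'y set \<Rightarrow> 'y word set \<Rightarrow> nat \<Rightarrow> (nat \<Rightarrow> 'x word) \<Rightarrow> (nat \<Rightarrow> 'y word) \<Rightarrow>
   ('x + 'y) word \<Rightarrow> ('x + 'y) word set"
where
  "amalgam_class X RA Y RB n u v = pres_class (X <+> Y) (amalgam_relators RA RB n u v)"

definition amalgam ::
  "'x set \<Rightarrow> 'x word set \<Rightarrow> 'y set \<Rightarrow> 'y word set \<Rightarrow> nat \<Rightarrow> (nat \<Rightarrow> 'x word) \<Rightarrow> (nat \<Rightarrow> 'y word) \<Rightarrow>
   ('x + 'y) word set monoid"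
where
  "amalgam X RA Y RB n u v = presented_group (X <+> Y) (amalgam_relators RA RB n u v)"

text \<open>
  The canonical maps from \<open>A\<close> and \<open>B\<close> to \<open>G\<close>: every word representing the given element
  represents the same element of \<open>G\<close>.
\<close>

definition canon_A ::
  "'x set \<Rightarrow> 'x word set \<Rightarrow> 'y set \<Rightarrow> 'y word set \<Rightarrow> nat \<Rightarrow> (nat \<Rightarrow> 'x word) \<Rightarrow> (nat \<Rightarrow> 'y word) \<Rightarrow>
   'x word set \<Rightarrow> ('x + 'y) word set"
where
  "canon_A X RA Y RB n u v a = (\<Union>w\<in>a. amalgam_class X RA Y RB n u v (map (apfst Inl) w))"

definition canon_B ::
  "'x set \<Rightarrow> 'x word set \<Rightarrow> 'y set \<Rightarrow> 'y word set \<Rightarrow> nat \<Rightarrow> (nat \<Rightarrow> 'x word) \<Rightarrow> (nat \<Rightarrow> 'y word) \<Rightarrow>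
   'y word set \<Rightarrow> ('x + 'y) word set"
where
  "canon_B X RA Y RB n u v b = (\<Union>w\<in>b. amalgam_class X RA Y RB n u v (map (apfst Inr) w))"

text \<open>\<open>H\<close> is the subgroup and \<open>S\<close> a set of elements of \<open>K\<close>; \<open>rcosets\<close> are the sets \<open>H #> a\<close>.\<close>

definition right_transversal :: "('a, 'm) monoid_scheme \<Rightarrow> 'a set \<Rightarrow> 'a set \<Rightarrow> bool" where
  "right_transversal K H S \<longleftrightarrow>
     S \<subseteq> carrier K \<and> \<one>\<^bsub>K\<^esub> \<in> S \<and> (\<forall>D \<in> rcosets\<^bsub>K\<^esub> H. \<exists>!s. s \<in> S \<and> s \<in> D)"

text \<open>
  In the next two definitions \<open>A\<close>, \<open>B\<close>, \<open>C\<close>, \<open>S\<close>, \<open>T\<close> are subsets of the group \<open>G\<close>, and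
  \<open>(c, ps)\<close> stands for the expression \<open>c p\<^sub>1 \<dots> p\<^sub>m\<close>.
\<close>

definition normal_expression ::
  "('g, 'm) monoid_scheme \<Rightarrow> 'g set \<Rightarrow> 'g set \<Rightarrow> 'g set \<Rightarrow> 'g set \<Rightarrow> 'g set \<Rightarrow> 'g \<Rightarrow> 'g \<times> 'g list \<Rightarrow> bool"
where
  "normal_expression G A B C S T g e \<longleftrightarrow>
     (case e of (c, ps) \<Rightarrow>
        c \<in> C \<and> set ps \<subseteq> (S \<union> T) - {\<one>\<^bsub>G\<^esub>} \<and>
        successively (\<lambda>p q. \<not> (p \<in> A \<and> q \<in> A) \<and> \<not> (p \<in> B \<and> q \<in> B)) ps \<and>
        g = c \<otimes>\<^bsub>G\<^esub> foldr (\<otimes>\<^bsub>G\<^esub>) ps \<one>\<^bsub>G\<^esub>)"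

definition is_normal_form ::
  "('g, 'm) monoid_scheme \<Rightarrow> 'g set \<Rightarrow> 'g set \<Rightarrow> 'g set \<Rightarrow> 'g set \<Rightarrow> 'g set \<Rightarrow> 'g \<Rightarrow> 'g \<times> 'g list \<Rightarrow> bool"
where
  "is_normal_form G A B C S T g e \<longleftrightarrow>
     normal_expression G A B C S T g e \<and>
     (\<forall>e'. normal_expression G A B C S T g e' \<longrightarrow> e' = e)"


section \<open>The two search problems\<close>

text \<open>
  \<open>H\<close> is a subgroup of \<open>\<langle>X | R\<rangle>\<close> generated by the elements represented by \<open>u 0, \<dots>, u (n - 1)\<close>.
  The answer \<open>Some c\<close> means that the word \<open>c(u)\<close> represents the same element as the input.
\<close>

definition solves_membership_search ::
  "'x set \<Rightarrow> 'x word set \<Rightarrow> 'x word set set \<Rightarrow> nat \<Rightarrow> (nat \<Rightarrow> 'x word) \<Rightarrow> ('x word \<Rightarrow> nat word option) \<Rightarrow> bool"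
where
  "solves_membership_search X R H n u m \<longleftrightarrow>
     (\<forall>w\<in>words X. case m w of
        None \<Rightarrow> pres_class X R w \<notin> H
      | Some c \<Rightarrow> pres_class X R w \<in> H \<and> c \<in> words {..<n} \<and>
          pres_class X R (subst_word u c) = pres_class X R w) \<and>
     computable_on (words X) (word_code X) (option_code (word_code {..<n})) m"

definition solves_coset_rep_search ::
  "'x set \<Rightarrow> 'x word set \<Rightarrow> 'x word set set \<Rightarrow> 'x word set \<Rightarrow> ('x word \<Rightarrow> 'x word) \<Rightarrow> bool"
where
  "solves_coset_rep_search X R H S r \<longleftrightarrow>
     (\<forall>w\<in>words X. r w \<in> S \<and> pres_class X R (r w) \<in> H #>\<^bsub>presented_group X R\<^esub> pres_class X R w) \<and>
     computable_on (words X) (word_code X) (word_code X) r"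


section \<open>Algorithm II\<close>

type_synonym ('x, 'y) syllable = "'x word + 'y word"

primrec syl_word :: "('x, 'y) syllable \<Rightarrow> ('x + 'y) word" where
  "syl_word (Inl w) = map (apfst Inl) w"
| "syl_word (Inr w) = map (apfst Inr) w"

definition input_words :: "'x set \<Rightarrow> 'y set \<Rightarrow> ('x, 'y) syllable list set" where
  "input_words X Y =
     {gs. set gs \<subseteq> {w \<in> words X. reduced w} <+> {w \<in> words Y. reduced w} \<and>
          successively (\<lambda>s t. isl s \<noteq> isl t) gs}"

text \<open>
  A state \<open>(c, gs, ps)\<close> stands for the word \<open>c g\<^sub>1 \<dots> g\<^sub>i p\<^sub>i\<^sub>+\<^sub>1 \<dots> p\<^sub>m\<close>. The leading coefficient \<open>c\<close>
  is kept as a word in the generators of \<open>C\<close>; it is empty as long as syllables \<open>g\<^sub>j\<close> remain.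
\<close>

type_synonym ('x, 'y) state = "nat word \<times> ('x, 'y) syllable list \<times> ('x, 'y) syllable list"

fun join :: "('x, 'y) syllable \<Rightarrow> ('x, 'y) syllable \<Rightarrow> ('x, 'y) syllable option" where
  "join (Inl p) (Inl q) = Some (Inl (p @ q))"
| "join (Inr p) (Inr q) = Some (Inr (p @ q))"
| "join _ _ = None"

text \<open>
  \<open>absorb\<close> multiplies the last remaining syllable on the right by \<open>c\<close>, written in the generators of
  \<open>C\<close> in the factor of that syllable (for alternating syllables, the factor that \<open>c\<close> does not come
  from).
\<close>

definition absorb ::
  "(nat \<Rightarrow> 'x word) \<Rightarrow> (nat \<Rightarrow> 'y word) \<Rightarrow> nat word \<Rightarrow> nat word \<times> ('x, 'y) syllable list \<Rightarrow>
   nat word \<times> ('x, 'y) syllable list"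
where
  "absorb u v c = (\<lambda>(c1, gs).
     if gs = [] then (c1 @ c, [])
     else (c1, butlast gs @
       [case last gs of Inl w \<Rightarrow> Inl (w @ subst_word u c) | Inr w \<Rightarrow> Inr (w @ subst_word v c)]))"

context
  fixes mA :: "'x word \<Rightarrow> nat word option" and rA :: "'x word \<Rightarrow> 'x word"
    and mB :: "'y word \<Rightarrow> nat word option" and rB :: "'y word \<Rightarrow> 'y word"
    and u :: "nat \<Rightarrow> 'x word" and v :: "nat \<Rightarrow> 'y word"
begin

text \<open>Writing a syllable as \<open>c p\<close>, with \<open>p\<close> a representative and \<open>c\<close> a word in the generators of \<open>C\<close>.\<close>

primrec split_syl :: "('x, 'y) syllable \<Rightarrow> nat word \<times> ('x, 'y) syllable" where
  "split_syl (Inl w) = (the (mA (w @ inv_word (rA w))), Inl (rA w))"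
| "split_syl (Inr w) = (the (mB (w @ inv_word (rB w))), Inr (rB w))"

text \<open>
  The test whether a representative equals \<open>1\<close>: as \<open>1\<close> is the representative of \<open>C\<close>, this is the
  question whether it lies in \<open>C\<close>, which the membership algorithm answers.
\<close>

primrec trivial_rep :: "('x, 'y) syllable \<Rightarrow> bool" where
  "trivial_rep (Inl p) \<longleftrightarrow> mA p \<noteq> None"
| "trivial_rep (Inr p) \<longleftrightarrow> mB p \<noteq> None"

text \<open>Steps 1 and 2 of the algorithm; Step 1 is the case \<open>ps = []\<close>.\<close>

definition algorithm_II_step :: "('x, 'y) state \<Rightarrow> ('x, 'y) state" where
  "algorithm_II_step = (\<lambda>(c1, gs, ps).
     let (c, p) = split_syl (last gs);
         (c1', gs') = absorb u v c (c1, butlast gs)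
     in if trivial_rep p then (c1', gs', ps)
        else case ps of
          [] \<Rightarrow> (c1', gs', [p])
        | q # qs \<Rightarrow>
            (case join p q of
               None \<Rightarrow> (c1', gs', p # ps)
             | Some pq \<Rightarrow>
                 let (c', p') = split_syl pq;
                     (c1'', gs'') = absorb u v c' (c1', gs')
                 in (c1'', gs'', if trivial_rep p' then qs else p' # qs)))"

text \<open>The result is \<^const>\<open>None\<close> iff the algorithm does not terminate.\<close>

definition algorithm_II ::
  "('x, 'y) syllable list \<Rightarrow> (nat word \<times> ('x, 'y) syllable list) option"
where
  "algorithm_II gs =
     map_option (\<lambda>(c, _, ps). (c, ps))
       (while_option (\<lambda>(_, gs', _). gs' \<noteq> []) algorithm_II_step ([], gs, []))"

end

definition syl_code :: "'x set \<Rightarrow> 'y set \<Rightarrow> ('x, 'y) syllable \<Rightarrow> nat" where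
  "syl_code X Y s = (case s of
     Inl w \<Rightarrow> prod_encode (0, word_code X w) | Inr w \<Rightarrow> prod_encode (1, word_code Y w))"

definition syls_code :: "'x set \<Rightarrow> 'y set \<Rightarrow> ('x, 'y) syllable list \<Rightarrow> nat" where
  "syls_code X Y gs = list_encode (map (syl_code X Y) gs)"

definition output_code ::
  "'x set \<Rightarrow> 'y set \<Rightarrow> nat \<Rightarrow> nat word \<times> ('x, 'y) syllable list \<Rightarrow> nat"
where
  "output_code X Y n = (\<lambda>(c, ps). prod_encode (word_code {..<n} c, syls_code X Y ps))"

end

theory Submission
  imports Defs
begin

text \<open>
  Each step of Algorithm II removes one of the syllables \<open>g\<^sub>j\<close>, so the loop terminates, and it preserves
  the represented element of \<open>G\<close> and the shape of the tail: nontrivial representatives from alternating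
  factors. To see that the resulting expression is the only normal form, use van der Waerden's
  method: let \<open>A\<close> and \<open>B\<close> act on formal normal forms by left multiplication. The two actions agree on \<open>C\<close>, so
  equal elements of \<open>G\<close> act equally, and a normal expression, applied to the empty normal form,
  reproduces itself. In particular nontrivial representatives from one factor do not lie in the other.
  For computability, the loop is a fold of the guarded step over the input list, and the step is
  composed of the given procedures and list operations on codes.
\<close>

section \<open>Closure properties of recursive functions\<close>

text \<open>Two obstacles shape the proof. The group G is only a quotient of words, so the action is
  defined letter by letter on words and then shown invariant under \<open>pres_eq\<close>. Moreover
  \<open>normal_expression\<close> speaks of elements of G and tests alternation by membership in A
  and B, whereas formal syllables carry a tag. Passing from tags to membership needs the separation
  of nontrivial representatives, which is itself a consequence of uniqueness; hence uniqueness is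
  settled for tagged expressions first.

  The second obstacle is that the search procedures are arbitrary functions, specified only on words
  over the right alphabet, and \<open>computable_on\<close> promises nothing outside its domain.
  Closure lemmas therefore carry a domain, branches are treated on their own part of it, and the
  loop is followed on a set of states closed under the step.

  Since S and T are sets of words and only their classes form transversals, uniqueness of the output
  concerns elements of G, not words.\<close>

lemma recursive_id: "recursive_fn (\<lambda>a. a)"
  using recursive_fn.pair[OF recursive_fn.left recursive_fn.right] by simp

lemma recursive_const: "recursive_fn (\<lambda>_. k)"
  by (induction k) (use recursive_fn.zero recursive_fn.comp[OF recursive_fn.succ] in auto)

lemma recursive_fst: "recursive_fn f \<Longrightarrow> recursive_fn (\<lambda>a. fst (prod_decode (f a)))"
  by (rule recursive_fn.comp[OF recursive_fn.left])

lemma recursive_snd: "recursive_fn f \<Longrightarrow> recursive_fn (\<lambda>a. snd (prod_decode (f a)))"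
  by (rule recursive_fn.comp[OF recursive_fn.right])

text \<open>\<open>prec\<close> reads parameter and depth off the two halves of its argument.
  Feeding it the pair of \<open>a\<close> and \<open>h a\<close> makes the depth depend on
  \<open>a\<close>, while all of \<open>a\<close> stays available as parameter.\<close>

lemma recursive_rec_nat:
  assumes "recursive_fn f" "recursive_fn g" "recursive_fn h"
  shows "recursive_fn (\<lambda>a. rec_nat (f a) (\<lambda>k r. g (prod_encode (a, prod_encode (k, r)))) (h a))"
  using recursive_fn.comp[OF recursive_fn.prec[OF assms(1,2)]
      recursive_fn.pair[OF recursive_id assms(3)]]
  by simp

lemma recursive_pred:
  assumes "recursive_fn f"
  shows "recursive_fn (\<lambda>a. f a - 1)"
proof -
  \<comment> \<open>The step returns the counter and forgets the previous value; at depth 0 the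
    start value agrees with truncated subtraction.\<close>
  have "rec_nat 0 (\<lambda>k r. k) m = m - 1" for m :: nat
    by (cases m) auto
  then show ?thesis
    using recursive_rec_nat[OF recursive_const recursive_fst[OF recursive_snd[OF recursive_id]] assms, of 0]
    by simp
qed

text \<open>Branching is a recursion whose step ignores counter and previous value: depth 0 yields
  the start value, any other depth the step value.\<close>

lemma recursive_if_zero:
  assumes "recursive_fn h" "recursive_fn f" "recursive_fn g"
  shows "recursive_fn (\<lambda>a. if h a = 0 then f a else g a)"
proof -
  have "rec_nat p (\<lambda>k r. q) m = (if m = 0 then p else q)" for m and p q :: nat
    by (cases m) auto
  then show ?thesis
    using recursive_rec_nat[OF assms(2) recursive_fn.comp[OF assms(3) recursive_fst[OF recursive_id]] assms(1)]
    by simp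
qed

lemma recursive_funpow:
  assumes "recursive_fn f" "recursive_fn g" "recursive_fn h"
  shows "recursive_fn (\<lambda>a. (f ^^ h a) (g a))"
proof -
  have "rec_nat p (\<lambda>k. f) m = (f ^^ m) p" for p m
    by (induction m) auto
  then show ?thesis
    using recursive_rec_nat[OF assms(2)
        recursive_fn.comp[OF assms(1) recursive_snd[OF recursive_snd[OF recursive_id]]] assms(3)]
    by simp
qed

lemma recursive_of_bool_eq:
  assumes "recursive_fn f"
  shows "recursive_fn (\<lambda>a. of_bool (f a = k))"
  using assms
proof (induction k arbitrary: f)
  case 0
  then show ?case
    using recursive_if_zero[OF 0 recursive_const recursive_const, of 1 0] by (simp add: of_bool_def)
next
  case (Suc k)
  \<comment> \<open>Zero is tested first, because \<open>0 - 1 = 0\<close> would let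
    \<open>f a = 0\<close> pass the test for \<open>k = 0\<close>.\<close>
  have "recursive_fn (\<lambda>a. if f a = 0 then 0 else of_bool (f a - 1 = k))"
    by (intro recursive_if_zero recursive_const Suc.IH recursive_pred Suc.prems)
  moreover have "(\<lambda>a. if f a = 0 then 0 else of_bool (f a - 1 = k)) = (\<lambda>a. of_bool (f a = Suc k) :: nat)"
    by (intro ext) (simp add: of_bool_def, linarith)
  ultimately show ?case by simp
qed

text \<open>A finite table is a nested case distinction, so arbitrary values may be prescribed. This
  is how the fixed words u_i and v_i enter a recursive function.\<close>

lemma recursive_finite_interpolation:
  assumes "finite I"
  shows "\<exists>f. recursive_fn f \<and> (\<forall>i\<in>I. f i = h i)"
  using assms
proof (induction I)
  case empty
  then show ?case using recursive_id by blast
next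
  case (insert i I)
  then obtain f where f: "recursive_fn f" "\<forall>i\<in>I. f i = h i" by blast
  let ?f = "\<lambda>a. if of_bool (a = i) = (0::nat) then f a else h i"
  have "recursive_fn ?f"
    by (intro recursive_if_zero recursive_of_bool_eq recursive_id f recursive_const)
  moreover have "\<forall>j\<in>insert i I. ?f j = h j" using f by auto
  ultimately show ?case by blast
qed


section \<open>Computable functions on coded data\<close>

text \<open>Codes parametrised by the codes of the components. The codes of words, syllables and
  outputs are instances, so lemmas about pairs, lists and sums serve them all.\<close>

definition pair_code :: "('a \<Rightarrow> nat) \<Rightarrow> ('b \<Rightarrow> nat) \<Rightarrow> 'a \<times> 'b \<Rightarrow> nat" where
  "pair_code e e' = (\<lambda>(a, b). prod_encode (e a, e' b))"

definition list_code :: "('a \<Rightarrow> nat) \<Rightarrow> 'a list \<Rightarrow> nat" where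
  "list_code e xs = list_encode (map e xs)"

definition sum_code :: "('a \<Rightarrow> nat) \<Rightarrow> ('b \<Rightarrow> nat) \<Rightarrow> 'a + 'b \<Rightarrow> nat" where
  "sum_code e e' s = (case s of Inl a \<Rightarrow> prod_encode (0, e a) | Inr b \<Rightarrow> prod_encode (1, e' b))"

lemma list_code_simps [simp]:
  "list_code e [] = 0"
  "list_code e (x # xs) = Suc (prod_encode (e x, list_code e xs))"
  by (simp_all add: list_code_def)

lemma computable_onI:
  "recursive_fn f \<Longrightarrow> (\<And>x. x \<in> D \<Longrightarrow> f (e x) = e' (h x)) \<Longrightarrow> computable_on D e e' h"
  by (auto simp: computable_on_def)

text \<open>Transfer from codes to data: \<open>t\<close> has to be right only on codes of values of
  \<open>f\<close>, not on arbitrary numbers.\<close>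

lemma computable_on_unary:
  assumes "computable_on D e e1 f" "recursive_fn t" "\<And>x. x \<in> D \<Longrightarrow> t (e1 (f x)) = e2 (h x)"
  shows "computable_on D e e2 h"
proof -
  obtain r where "recursive_fn r" "\<forall>x\<in>D. r (e x) = e1 (f x)"
    using assms(1) by (auto simp: computable_on_def)
  then show ?thesis
    using assms(3) by (intro computable_onI[OF recursive_fn.comp[OF assms(2)]]) auto
qed

lemma computable_on_binary:
  assumes "computable_on D e e1 f" "computable_on D e e2 g" "recursive_fn t"
    and "\<And>x. x \<in> D \<Longrightarrow> t (prod_encode (e1 (f x), e2 (g x))) = e3 (h x)"
  shows "computable_on D e e3 h"
proof -
  obtain r s where r: "recursive_fn r" "\<forall>x\<in>D. r (e x) = e1 (f x)"
    and s: "recursive_fn s" "\<forall>x\<in>D. s (e x) = e2 (g x)"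
    using assms(1,2) by (auto simp: computable_on_def)
  then show ?thesis
    using assms(4)
    by (intro computable_onI[OF recursive_fn.comp[OF assms(3) recursive_fn.pair[OF r(1) s(1)]]]) auto
qed

lemma computable_on_subset: "computable_on D e e' h \<Longrightarrow> D' \<subseteq> D \<Longrightarrow> computable_on D' e e' h"
  by (auto simp: computable_on_def)

lemma computable_on_cong:
  "computable_on D e e' h \<Longrightarrow> (\<And>x. x \<in> D \<Longrightarrow> h x = h' x) \<Longrightarrow> computable_on D e e' h'"
  by (auto simp: computable_on_def)

lemma computable_on_id: "computable_on D e e (\<lambda>x. x)"
  by (rule computable_onI[OF recursive_id]) simp

lemma computable_on_const: "computable_on D e e' (\<lambda>x. c)"
  by (rule computable_onI[OF recursive_const]) simp

lemma computable_on_finite: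
  assumes "finite D" "inj_on e D"
  shows "computable_on D e e' h"
proof -
  obtain f where "recursive_fn f" "\<forall>i\<in>e ` D. f i = e' (h (the_inv_into D e i))"
    using recursive_finite_interpolation[of "e ` D" "\<lambda>i. e' (h (the_inv_into D e i))"] assms(1) by blast
  then show ?thesis
    by (intro computable_onI) (auto simp: the_inv_into_f_f[OF assms(2)])
qed

lemma computable_on_comp:
  assumes "computable_on E e1 e2 h" "computable_on D e e1 f" "\<And>x. x \<in> D \<Longrightarrow> f x \<in> E"
  shows "computable_on D e e2 (\<lambda>x. h (f x))"
proof -
  obtain r where r: "recursive_fn r" "\<forall>y\<in>E. r (e1 y) = e2 (h y)"
    using assms(1) by (auto simp: computable_on_def)
  show ?thesis
    by (rule computable_on_unary[OF assms(2) r(1)]) (simp add: r(2) assms(3))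
qed

lemma computable_on_Pair:
  assumes "computable_on D e e1 f" "computable_on D e e2 g"
  shows "computable_on D e (pair_code e1 e2) (\<lambda>x. (f x, g x))"
  by (rule computable_on_binary[OF assms recursive_id]) (simp add: pair_code_def)

lemma computable_on_fst:
  assumes "computable_on D e (pair_code e1 e2) f"
  shows "computable_on D e e1 (\<lambda>x. fst (f x))"
  by (rule computable_on_unary[OF assms recursive_fn.left]) (simp add: pair_code_def split: prod.split)

lemma computable_on_snd:
  assumes "computable_on D e (pair_code e1 e2) f"
  shows "computable_on D e e2 (\<lambda>x. snd (f x))"
  by (rule computable_on_unary[OF assms recursive_fn.right]) (simp add: pair_code_def split: prod.split)

text \<open>The recursive functions behind the branches are total, so their values on the wrong side
  are simply discarded. Each branch matters only where it is taken, which admits branches using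
  \<open>hd\<close>, \<open>the\<close> or \<open>projl\<close>.\<close>

lemma computable_on_if:
  assumes "computable_on D e of_bool P"
    and "computable_on {x\<in>D. P x} e e' f" "computable_on {x\<in>D. \<not> P x} e e' g"
  shows "computable_on D e e' (\<lambda>x. if P x then f x else g x)"
proof -
  obtain r s t where "recursive_fn r" "\<forall>x\<in>D. r (e x) = of_bool (P x)"
    "recursive_fn s" "\<forall>x\<in>{x\<in>D. P x}. s (e x) = e' (f x)"
    "recursive_fn t" "\<forall>x\<in>{x\<in>D. \<not> P x}. t (e x) = e' (g x)"
    using assms by (auto simp: computable_on_def)
  then show ?thesis
    by (intro computable_onI[where f = "\<lambda>a. if r a = 0 then t a else s a"] recursive_if_zero) auto
qed

lemma computable_on_not:
  assumes "computable_on D e of_bool P"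
  shows "computable_on D e of_bool (\<lambda>x. \<not> P x)"
  by (rule computable_on_unary[OF assms recursive_of_bool_eq[OF recursive_id, of 0]]) simp

lemma computable_on_bool_eq:
  assumes "computable_on D e of_bool P" "computable_on D e of_bool Q"
  shows "computable_on D e of_bool (\<lambda>x. P x = Q x)"
proof -
  have "computable_on D e of_bool (\<lambda>x. if P x then Q x else \<not> Q x)"
    by (intro computable_on_if assms computable_on_subset[OF assms(2)]
        computable_on_subset[OF computable_on_not[OF assms(2)]]) auto
  then show ?thesis
    by (rule computable_on_cong) auto
qed

section \<open>Operations on sums and options\<close>

lemma computable_on_isl:
  assumes "computable_on D e (sum_code e1 e2) f"
  shows "computable_on D e of_bool (\<lambda>x. isl (f x))"
  by (rule computable_on_unary[OF assms recursive_of_bool_eq[OF recursive_fn.left, of 0]])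
    (simp add: sum_code_def split: sum.split)

lemma computable_on_projl:
  assumes "computable_on D e (sum_code e1 e2) f" "\<And>x. x \<in> D \<Longrightarrow> isl (f x)"
  shows "computable_on D e e1 (\<lambda>x. projl (f x))"
  by (rule computable_on_unary[OF assms(1) recursive_fn.right])
    (use assms(2) in \<open>fastforce simp: sum_code_def isl_def split: sum.split\<close>)

lemma computable_on_projr:
  assumes "computable_on D e (sum_code e1 e2) f" "\<And>x. x \<in> D \<Longrightarrow> \<not> isl (f x)"
  shows "computable_on D e e2 (\<lambda>x. projr (f x))"
  by (rule computable_on_unary[OF assms(1) recursive_fn.right])
    (use assms(2) in \<open>fastforce simp: sum_code_def isl_def split: sum.split\<close>)

lemma computable_on_Inl:
  assumes "computable_on D e e1 f"
  shows "computable_on D e (sum_code e1 e2) (\<lambda>x. Inl (f x))"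
  by (rule computable_on_unary[OF assms recursive_fn.pair[OF recursive_const recursive_id]])
    (simp add: sum_code_def)

lemma computable_on_Inr:
  assumes "computable_on D e e2 f"
  shows "computable_on D e (sum_code e1 e2) (\<lambda>x. Inr (f x))"
  by (rule computable_on_unary[OF assms recursive_fn.pair[OF recursive_const recursive_id]])
    (simp add: sum_code_def)

text \<open>The pattern variables appear as \<open>projl\<close> and \<open>projr\<close> of the
  scrutinee, so that each branch is a function of the argument alone, as the closure lemmas
  expect.\<close>

lemma computable_on_case_sum:
  assumes "computable_on D e (sum_code e1 e2) s"
    and "computable_on {x\<in>D. isl (s x)} e e' (\<lambda>x. f x (projl (s x)))"
    and "computable_on {x\<in>D. \<not> isl (s x)} e e' (\<lambda>x. g x (projr (s x)))"
  shows "computable_on D e e' (\<lambda>x. case s x of Inl a \<Rightarrow> f x a | Inr b \<Rightarrow> g x b)"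
  by (rule computable_on_cong[OF computable_on_if[OF computable_on_isl[OF assms(1)] assms(2,3)]])
    (simp split: sum.split)

lemma computable_on_is_Some:
  assumes "computable_on D e (option_code e') f"
  shows "computable_on D e of_bool (\<lambda>x. f x \<noteq> None)"
proof -
  have "of_bool (option_code e' y = 0) = (of_bool (y = None) :: nat)" for y
    by (cases y) auto
  then have "computable_on D e of_bool (\<lambda>x. f x = None)"
    by (intro computable_on_unary[OF assms recursive_of_bool_eq[OF recursive_id]])
  then show ?thesis
    by (rule computable_on_not)
qed

lemma computable_on_the:
  assumes "computable_on D e (option_code e') f" "\<And>x. x \<in> D \<Longrightarrow> f x \<noteq> None"
  shows "computable_on D e e' (\<lambda>x. the (f x))"
  by (rule computable_on_unary[OF assms(1) recursive_pred[OF recursive_id]]) (use assms(2) in force)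

section \<open>Operations on lists\<close>

lemma computable_on_is_Nil:
  assumes "computable_on D e (list_code e') f"
  shows "computable_on D e of_bool (\<lambda>x. f x = [])"
proof -
  have "of_bool (list_code e' y = 0) = (of_bool (y = []) :: nat)" for y
    by (cases y) auto
  then show ?thesis
    by (intro computable_on_unary[OF assms recursive_of_bool_eq[OF recursive_id]])
qed

lemma computable_on_Cons:
  assumes "computable_on D e e' f" "computable_on D e (list_code e') g"
  shows "computable_on D e (list_code e') (\<lambda>x. f x # g x)"
  by (rule computable_on_binary[OF assms recursive_fn.succ]) simp

lemma computable_on_hd:
  assumes "computable_on D e (list_code e') f" "\<And>x. x \<in> D \<Longrightarrow> f x \<noteq> []"
  shows "computable_on D e e' (\<lambda>x. hd (f x))"
proof -
  have "fst (prod_decode (list_code e' y - 1)) = e' (hd y)" if "y \<noteq> []" for y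
    using that by (cases y) auto
  then show ?thesis
    using assms(2) by (intro computable_on_unary[OF assms(1) recursive_fst[OF recursive_pred[OF recursive_id]]]) auto
qed

lemma computable_on_tl:
  assumes "computable_on D e (list_code e') f"
  shows "computable_on D e (list_code e') (\<lambda>x. tl (f x))"
proof -
  \<comment> \<open>This covers the empty list: its code 0 is fixed by the predecessor, and decoding
    0 gives second component 0, the code of \<open>tl []\<close>.\<close>
  have "snd (prod_decode 0) = 0"
    by (simp add: prod_decode_def prod_decode_aux.simps)
  then have "snd (prod_decode (list_code e' y - 1)) = list_code e' (tl y)" for y
    by (cases y) auto
  then show ?thesis
    by (intro computable_on_unary[OF assms recursive_snd[OF recursive_pred[OF recursive_id]]])
qed

lemma length_le_list_code: "length xs \<le> list_code e xs"
proof (induction xs)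
  case (Cons x xs)
  then show ?case using le_prod_encode_2[of "list_code e xs" "e x"] by simp
qed simp

text \<open>The code of a list bounds its length, so the fold takes at most that many iterations of a
  step which leaves the state alone once the list is used up.\<close>

lemma computable_on_foldl:
  assumes h: "computable_on (E \<times> F) (pair_code e1 e2) e1 (\<lambda>(b, a). h b a)"
    and closed: "\<And>b a. b \<in> E \<Longrightarrow> a \<in> F \<Longrightarrow> h b a \<in> E"
    and g: "computable_on D e e1 g" "\<And>x. x \<in> D \<Longrightarrow> g x \<in> E"
    and f: "computable_on D e (list_code e2) f" "\<And>x. x \<in> D \<Longrightarrow> set (f x) \<subseteq> F"
  shows "computable_on D e e1 (\<lambda>x. foldl h (g x) (f x))"
proof -
  obtain r where r: "recursive_fn r" "\<And>b a. b \<in> E \<Longrightarrow> a \<in> F \<Longrightarrow> r (prod_encode (e1 b, e2 a)) = e1 (h b a)"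
    using h by (auto simp: computable_on_def pair_code_def)
  \<comment> \<open>The argument of \<open>s\<close> packs the coded accumulator with the coded rest
    of the list; the initial second component doubles as the number of rounds.\<close>
  define s where "s = (\<lambda>a. if snd (prod_decode a) = 0 then a
    else prod_encode (r (prod_encode (fst (prod_decode a), fst (prod_decode (snd (prod_decode a) - 1)))),
        snd (prod_decode (snd (prod_decode a) - 1))))"
  have "recursive_fn s"
    unfolding s_def
    by (intro recursive_if_zero recursive_snd recursive_fst recursive_id recursive_fn.pair
        recursive_pred recursive_fn.comp[OF r(1)])
  then have rec: "recursive_fn (\<lambda>a. fst (prod_decode ((s ^^ snd (prod_decode a)) a)))"
    by (intro recursive_fst recursive_funpow recursive_id recursive_snd)
  have stop: "(s ^^ k) (prod_encode (b, 0)) = prod_encode (b, 0)" for k b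
    by (induction k) (auto simp: s_def)
  have iter: "(s ^^ k) (prod_encode (e1 b, list_code e2 xs)) = prod_encode (e1 (foldl h b xs), 0)"
    if "length xs \<le> k" "b \<in> E" "set xs \<subseteq> F" for k b xs
    using that
  proof (induction xs arbitrary: b k)
    case Nil
    then show ?case by (simp add: stop)
  next
    case (Cons x xs)
    then obtain k' where k: "k = Suc k'" by (cases k) auto
    have "s (prod_encode (e1 b, list_code e2 (x # xs))) = prod_encode (e1 (h b x), list_code e2 xs)"
      using Cons.prems by (simp add: s_def r)
    then show ?case
      using Cons.prems Cons.IH[of k' "h b x"] closed by (simp add: k funpow_swap1 del: list_code_simps)
  qed
  show ?thesis
    by (rule computable_on_binary[OF g(1) f(1) rec])
      (simp add: iter[OF length_le_list_code] g(2) f(2))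
qed

lemma computable_on_rev:
  assumes "computable_on D e (list_code e') f"
  shows "computable_on D e (list_code e') (\<lambda>x. rev (f x))"
proof -
  have "computable_on (UNIV \<times> UNIV) (pair_code (list_code e') e') (list_code e') (\<lambda>(b, a). a # b)"
    unfolding case_prod_unfold
    by (intro computable_on_Cons computable_on_fst computable_on_snd; rule computable_on_id)
  then have "computable_on D e (list_code e') (\<lambda>x. foldl (\<lambda>b a. a # b) [] (f x))"
    by (rule computable_on_foldl) (auto intro: computable_on_const assms)
  moreover have "foldl (\<lambda>b a. a # b) ys xs = rev xs @ ys" for xs ys :: "'b list"
    by (induction xs arbitrary: ys) auto
  ultimately show ?thesis by simp
qed

lemma computable_on_append:
  assumes "computable_on D e (list_code e') f" "computable_on D e (list_code e') g"
  shows "computable_on D e (list_code e') (\<lambda>x. f x @ g x)"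
proof -
  have "computable_on (UNIV \<times> UNIV) (pair_code (list_code e') e') (list_code e') (\<lambda>(b, a). a # b)"
    unfolding case_prod_unfold
    by (intro computable_on_Cons computable_on_fst computable_on_snd; rule computable_on_id)
  then have "computable_on D e (list_code e') (\<lambda>x. foldl (\<lambda>b a. a # b) (g x) (rev (f x)))"
    by (rule computable_on_foldl) (auto intro: computable_on_rev assms)
  moreover have "foldl (\<lambda>b a. a # b) ys (rev xs) = xs @ ys" for xs ys :: "'b list"
    by (induction xs) auto
  ultimately show ?thesis by simp
qed

text \<open>Codes give direct access to the head of a list only, so the last element is reached
  through reversal; likewise \<open>butlast\<close> below.\<close>

lemma computable_on_last:
  assumes "computable_on D e (list_code e') f" "\<And>x. x \<in> D \<Longrightarrow> f x \<noteq> []"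
  shows "computable_on D e e' (\<lambda>x. last (f x))"
  by (rule computable_on_cong[OF computable_on_hd[OF computable_on_rev[OF assms(1)]]])
    (use assms(2) in \<open>auto simp: hd_rev\<close>)

lemma computable_on_butlast:
  assumes "computable_on D e (list_code e') f"
  shows "computable_on D e (list_code e') (\<lambda>x. butlast (f x))"
  by (rule computable_on_cong[OF computable_on_rev[OF computable_on_tl[OF computable_on_rev[OF assms]]]])
    (simp add: butlast_rev[symmetric])

lemma computable_on_concat_map:
  assumes "computable_on F e2 (list_code e') k"
    and "computable_on D e (list_code e2) f" "\<And>x. x \<in> D \<Longrightarrow> set (f x) \<subseteq> F"
  shows "computable_on D e (list_code e') (\<lambda>x. concat (map k (f x)))"
proof -
  have "computable_on (UNIV \<times> F) (pair_code (list_code e') e2) (list_code e') (\<lambda>(b, a). b @ k a)"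
    unfolding case_prod_unfold
    by (intro computable_on_append computable_on_fst computable_on_comp[OF assms(1)]
        computable_on_snd; (rule computable_on_id)?) auto
  then have "computable_on D e (list_code e') (\<lambda>x. foldl (\<lambda>b a. b @ k a) [] (f x))"
    by (rule computable_on_foldl) (use assms in \<open>auto intro: computable_on_const\<close>)
  moreover have "foldl (\<lambda>b a. b @ k a) ys xs = ys @ concat (map k xs)" for xs ys
    by (induction xs arbitrary: ys) auto
  ultimately show ?thesis by simp
qed


section \<open>Presented groups\<close>

lemma words_Nil [simp]: "[] \<in> words X"
  by (simp add: words_def)

lemma words_Cons [simp]: "l # w \<in> words X \<longleftrightarrow> fst l \<in> X \<and> w \<in> words X"
  by (cases l) (auto simp: words_def)

lemma words_append [simp]: "v @ w \<in> words X \<longleftrightarrow> v \<in> words X \<and> w \<in> words X"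
  by (auto simp: words_def)

lemma inv_word_simps [simp]:
  "inv_word [] = []"
  "inv_word (l # w) = inv_word w @ [(fst l, \<not> snd l)]"
  "inv_word (v @ w) = inv_word w @ inv_word v"
  by (auto simp: inv_word_def case_prod_unfold)

lemma inv_word_in_words [simp]: "inv_word w \<in> words X \<longleftrightarrow> w \<in> words X"
  by (induction w) auto

lemma inv_word_map: "inv_word (map (apfst f) w) = map (apfst f) (inv_word w)"
  by (induction w) auto

lemma map_Inl_in_words [simp]: "map (apfst Inl) w \<in> words (X <+> Y) \<longleftrightarrow> w \<in> words X"
  by (induction w) auto

lemma map_Inr_in_words [simp]: "map (apfst Inr) w \<in> words (X <+> Y) \<longleftrightarrow> w \<in> words Y"
  by (induction w) auto

lemma subst_word_simps [simp]:
  "subst_word u [] = []"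
  "subst_word u (l # c) = (if snd l then u (fst l) else inv_word (u (fst l))) @ subst_word u c"
  "subst_word u (c @ d) = subst_word u c @ subst_word u d"
  by (auto simp: subst_word_def case_prod_unfold)

lemma subst_word_in_words:
  "(\<And>i. i < n \<Longrightarrow> u i \<in> words X) \<Longrightarrow> c \<in> words {..<n} \<Longrightarrow> subst_word u c \<in> words X"
  by (induction c) auto

locale presentation =
  fixes X :: "'x set" and R :: "'x word set"
  assumes relators: "R \<subseteq> words X"
begin

abbreviation "P \<equiv> presented_group X R"
abbreviation "cls \<equiv> pres_class X R"

lemma pres_eq_words: "pres_eq X R v w \<Longrightarrow> v \<in> words X \<and> w \<in> words X"
  by (induction rule: pres_eq.induct) (use relators in auto)

lemma pres_eq_context:
  assumes "pres_eq X R v w" "a \<in> words X" "b \<in> words X"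
  shows "pres_eq X R (a @ v @ b) (a @ w @ b)"
  using assms
proof (induction rule: pres_eq.induct)
  case (cancel p q x e)
  then show ?case using pres_eq.cancel[of "a @ p" X "q @ b" x R e] by simp
next
  case (relator p q r)
  then show ?case using pres_eq.relator[of "a @ p" X "q @ b" r R] by simp
qed (auto intro: pres_eq.intros)

lemma pres_eq_append:
  assumes "pres_eq X R v w" "pres_eq X R v' w'"
  shows "pres_eq X R (v @ v') (w @ w')"
  using pres_eq_context[OF assms(1), of "[]" v'] pres_eq_context[OF assms(2), of w "[]"]
    pres_eq_words[OF assms(1)] pres_eq_words[OF assms(2)]
  by (auto intro: pres_eq.trans)

lemma pres_eq_inverse: "w \<in> words X \<Longrightarrow> pres_eq X R (w @ inv_word w) []"
proof (induction w)
  case Nil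
  then show ?case by (auto intro: pres_eq.refl)
next
  case (Cons l w)
  have "pres_eq X R ([l] @ (w @ inv_word w) @ [(fst l, \<not> snd l)]) ([l] @ [] @ [(fst l, \<not> snd l)])"
    using Cons by (intro pres_eq_context) auto
  moreover have "pres_eq X R ([] @ [(fst l, snd l), (fst l, \<not> snd l)] @ []) ([] @ [])"
    using Cons by (intro pres_eq.cancel) auto
  ultimately show ?case
    by (auto intro: pres_eq.trans)
qed

lemma inv_word_inv_word [simp]: "inv_word (inv_word w) = w"
  by (induction w) auto

text \<open>One word suffices: \<open>v\<close> lies in its own class, hence in that of
  \<open>w\<close>, which relates the two.\<close>

lemma cls_eq_iff: "v \<in> words X \<Longrightarrow> cls v = cls w \<longleftrightarrow> pres_eq X R v w"
  unfolding pres_class_def by (blast intro: pres_eq.intros)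

lemma self_in_cls: "w \<in> words X \<Longrightarrow> w \<in> cls w"
  by (simp add: pres_class_def pres_eq.refl)

lemma cls_closed [simp]: "w \<in> words X \<Longrightarrow> cls w \<in> carrier P"
  by (simp add: presented_group_def)

lemma carrierE:
  assumes "g \<in> carrier P"
  obtains w where "w \<in> words X" "g = cls w"
  using assms by (auto simp: presented_group_def)

text \<open>The product is a union over all pairs of representatives. By congruence its members
  coincide, and the index sets are nonempty, so the union is a single class.\<close>

lemma cls_mult [simp]:
  assumes "v \<in> words X" "w \<in> words X"
  shows "cls v \<otimes>\<^bsub>P\<^esub> cls w = cls (v @ w)"
proof -
  have "cls (p @ q) = cls (v @ w)" if "p \<in> cls v" "q \<in> cls w" for p q
  proof -
    have "pres_eq X R (v @ w) (p @ q)"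
      using that by (auto simp: pres_class_def intro: pres_eq_append)
    then show ?thesis using assms cls_eq_iff[of "v @ w" "p @ q"] by simp
  qed
  then have "cls v \<otimes>\<^bsub>P\<^esub> cls w = (\<Union>p\<in>cls v. \<Union>q\<in>cls w. cls (v @ w))"
    by (simp add: presented_group_def)
  also have "\<dots> = cls (v @ w)"
    using self_in_cls[OF assms(1)] self_in_cls[OF assms(2)] by blast
  finally show ?thesis .
qed

lemma one_eq: "\<one>\<^bsub>P\<^esub> = cls []"
  by (simp add: presented_group_def)

lemma cls_inverse: "w \<in> words X \<Longrightarrow> cls w \<otimes>\<^bsub>P\<^esub> cls (inv_word w) = \<one>\<^bsub>P\<^esub>"
  using pres_eq_inverse by (simp add: cls_eq_iff one_eq)

lemma is_group: "group P"
proof (rule groupI)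
  fix g assume "g \<in> carrier P"
  then obtain w where w: "w \<in> words X" "g = cls w" by (rule carrierE)
  then show "\<exists>h\<in>carrier P. h \<otimes>\<^bsub>P\<^esub> g = \<one>\<^bsub>P\<^esub>"
    using cls_inverse[of "inv_word w"] by (intro bexI[of _ "cls (inv_word w)"]) auto
next
  show "\<one>\<^bsub>P\<^esub> \<in> carrier P" by (simp add: one_eq)
qed (auto elim!: carrierE simp: one_eq)

sublocale group P
  by (rule is_group)

lemma cls_inv: "w \<in> words X \<Longrightarrow> cls (inv_word w) = inv\<^bsub>P\<^esub> cls w"
  using inv_equality[of "cls (inv_word w)" "cls w"] cls_inverse[of "inv_word w"] by simp

end


section \<open>The action of a factor on normal forms\<close>

text \<open>
  \<open>J\<close> embeds the factor \<open>K\<close> into the alphabet of syllables. Every expression \<open>c p\<^sub>1 \<dots> p\<^sub>m\<close> is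
  uniquely an element of \<open>K\<close> followed by an expression that does not start with a syllable of \<open>K\<close>,
  and \<open>K\<close> acts by left multiplication on the first component.
\<close>

locale amalgam_factor = C: group C + K: group K
  for C :: "('c, 'm) monoid_scheme" and K :: "('k, 'l) monoid_scheme" +
  fixes \<phi> :: "'c \<Rightarrow> 'k" and S :: "'k set" and J :: "'k \<Rightarrow> 's" and N :: "'s set"
  assumes mono: "\<phi> \<in> mon C K"
    and transversal: "right_transversal K (\<phi> ` carrier C) S"
    and inj_J: "inj J"
    and N: "\<And>k. J k \<in> N \<longleftrightarrow> k \<in> S - {\<one>\<^bsub>K\<^esub>}"
begin

abbreviation own :: "'s \<Rightarrow> bool" where "own p \<equiv> p \<in> range J"

definition NF :: "('c \<times> 's list) set" where
  "NF = carrier C \<times> {ps. set ps \<subseteq> N \<and> successively (\<lambda>p q. own p \<noteq> own q) ps}"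

definition tails :: "'s list set" where
  "tails = {ps. set ps \<subseteq> N \<and> successively (\<lambda>p q. own p \<noteq> own q) ps \<and> (ps \<noteq> [] \<longrightarrow> \<not> own (hd ps))}"

definition rep :: "'k \<Rightarrow> 'k" where
  "rep k = (THE s. s \<in> S \<and> s \<in> \<phi> ` carrier C #>\<^bsub>K\<^esub> k)"

definition coef :: "'k \<Rightarrow> 'c" where
  "coef k = (THE c. c \<in> carrier C \<and> \<phi> c \<otimes>\<^bsub>K\<^esub> rep k = k)"

definition unpack :: "'c \<times> 's list \<Rightarrow> 'k \<times> 's list" where
  "unpack e = (if snd e \<noteq> [] \<and> own (hd (snd e))
     then (\<phi> (fst e) \<otimes>\<^bsub>K\<^esub> inv_into UNIV J (hd (snd e)), tl (snd e)) else (\<phi> (fst e), snd e))"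

definition pack :: "'k \<times> 's list \<Rightarrow> 'c \<times> 's list" where
  "pack d = (coef (fst d), if rep (fst d) = \<one>\<^bsub>K\<^esub> then snd d else J (rep (fst d)) # snd d)"

text \<open>Left translation is transported along the bijection between \<open>NF\<close> and the
  product of K with \<open>tails\<close>. The action laws then reduce to the group laws of K,
  without cases for cancellation or merging.\<close>

definition act :: "'k \<Rightarrow> 'c \<times> 's list \<Rightarrow> 'c \<times> 's list" where
  "act k e = pack (apfst ((\<otimes>\<^bsub>K\<^esub>) k) (unpack e))"

lemma phi_hom: "group_hom C K \<phi>"
  using mono by unfold_locales (auto simp: mon_def)

sublocale \<phi>: group_hom C K \<phi>
  by (rule phi_hom)

lemma phi_inj: "inj_on \<phi> (carrier C)"
  using mono by (simp add: mon_def)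

lemma image_subgroup: "subgroup (\<phi> ` carrier C) K"
  by (rule \<phi>.img_is_subgroup)

lemma S_carrier: "s \<in> S \<Longrightarrow> s \<in> carrier K"
  using transversal by (auto simp: right_transversal_def)

lemma ex1_representative:
  assumes "k \<in> carrier K"
  shows "\<exists>!s. s \<in> S \<and> s \<in> \<phi> ` carrier C #>\<^bsub>K\<^esub> k"
proof -
  have "\<phi> ` carrier C #>\<^bsub>K\<^esub> k \<in> rcosets\<^bsub>K\<^esub> (\<phi> ` carrier C)"
    using assms by (auto simp: RCOSETS_def)
  then show ?thesis
    using transversal by (simp add: right_transversal_def)
qed

lemma in_coset:
  assumes "c \<in> carrier C" "s \<in> carrier K"
  shows "s \<in> \<phi> ` carrier C #>\<^bsub>K\<^esub> (\<phi> c \<otimes>\<^bsub>K\<^esub> s)"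
proof -
  have "s = \<phi> (inv\<^bsub>C\<^esub> c) \<otimes>\<^bsub>K\<^esub> (\<phi> c \<otimes>\<^bsub>K\<^esub> s)"
    using assms by (simp add: K.m_assoc[symmetric])
  moreover have "\<phi> (inv\<^bsub>C\<^esub> c) \<in> \<phi> ` carrier C" using assms by blast
  ultimately show ?thesis unfolding r_coset_def by blast
qed

text \<open>\<open>s\<close> and \<open>t\<close> both represent the coset of the common product, so
  the transversal forces them to agree; cancelling them leaves the coefficients to injectivity of
  \<phi>.\<close>

lemma factorization_unique:
  assumes "c \<in> carrier C" "s \<in> S" "d \<in> carrier C" "t \<in> S"
    and eq: "\<phi> c \<otimes>\<^bsub>K\<^esub> s = \<phi> d \<otimes>\<^bsub>K\<^esub> t"
  shows "c = d" "s = t"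
proof -
  have "\<phi> c \<otimes>\<^bsub>K\<^esub> s \<in> carrier K"
    using assms(1,2) S_carrier by simp
  note rep = the1_equality[OF ex1_representative[OF this]]
  have "t \<in> \<phi> ` carrier C #>\<^bsub>K\<^esub> (\<phi> c \<otimes>\<^bsub>K\<^esub> s)"
    unfolding eq using assms by (intro in_coset S_carrier)
  note t = rep[OF conjI[OF assms(4) this]]
  have "s \<in> \<phi> ` carrier C #>\<^bsub>K\<^esub> (\<phi> c \<otimes>\<^bsub>K\<^esub> s)"
    using assms by (intro in_coset S_carrier)
  note s = rep[OF conjI[OF assms(2) this]]
  show st: "s = t"
    by (rule HOL.trans[OF s[symmetric] t])
  have "\<phi> c = \<phi> d"
    using eq st S_carrier[OF assms(4)] assms(1,3) by simp
  then show "c = d"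
    by (rule inj_onD[OF phi_inj _ assms(1,3)])
qed

lemma rep_coef:
  assumes "k \<in> carrier K"
  shows "rep k \<in> S" "coef k \<in> carrier C" "\<phi> (coef k) \<otimes>\<^bsub>K\<^esub> rep k = k"
proof -
  from theI'[OF ex1_representative[OF assms]] have r: "rep k \<in> S" "rep k \<in> \<phi> ` carrier C #>\<^bsub>K\<^esub> k"
    by (simp_all add: rep_def)
  then obtain c where c: "c \<in> carrier C" "rep k = \<phi> c \<otimes>\<^bsub>K\<^esub> k" by (auto simp: r_coset_def)
  then have "\<phi> (inv\<^bsub>C\<^esub> c) \<otimes>\<^bsub>K\<^esub> rep k = k"
    using assms by (simp add: K.m_assoc[symmetric])
  then have "\<exists>!c. c \<in> carrier C \<and> \<phi> c \<otimes>\<^bsub>K\<^esub> rep k = k"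
    using c(1) factorization_unique(1)[OF _ r(1) _ r(1)] C.inv_closed by metis
  from theI'[OF this] show "coef k \<in> carrier C" "\<phi> (coef k) \<otimes>\<^bsub>K\<^esub> rep k = k"
    by (simp_all add: coef_def)
  show "rep k \<in> S" by (rule r)
qed

lemma rep_coef_mult:
  assumes "c \<in> carrier C" "s \<in> S"
  shows "rep (\<phi> c \<otimes>\<^bsub>K\<^esub> s) = s" "coef (\<phi> c \<otimes>\<^bsub>K\<^esub> s) = c"
proof -
  have "\<phi> c \<otimes>\<^bsub>K\<^esub> s \<in> carrier K" using assms S_carrier by simp
  note * = rep_coef[OF this]
  show "rep (\<phi> c \<otimes>\<^bsub>K\<^esub> s) = s" by (rule factorization_unique(2)[OF *(2,1) assms *(3)])
  show "coef (\<phi> c \<otimes>\<^bsub>K\<^esub> s) = c" by (rule factorization_unique(1)[OF *(2,1) assms *(3)])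
qed

lemma one_in_S: "\<one>\<^bsub>K\<^esub> \<in> S"
  using transversal by (auto simp: right_transversal_def)

lemma rep_coef_image:
  assumes "c \<in> carrier C"
  shows "rep (\<phi> c) = \<one>\<^bsub>K\<^esub>" "coef (\<phi> c) = c"
  using rep_coef_mult[OF assms one_in_S] assms by auto

lemma J_N: "k \<in> S \<Longrightarrow> k \<noteq> \<one>\<^bsub>K\<^esub> \<Longrightarrow> J k \<in> N"
  by (simp add: N)

lemma J_eq [simp]: "J k = J k' \<longleftrightarrow> k = k'"
  using inj_J by (auto dest: injD)

lemma pack_closed: "k \<in> carrier K \<Longrightarrow> ps \<in> tails \<Longrightarrow> pack (k, ps) \<in> NF"
  by (cases ps) (auto simp: pack_def NF_def tails_def rep_coef J_N)

lemma unpack_closed: "e \<in> NF \<Longrightarrow> unpack e \<in> carrier K \<times> tails"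
  by (cases "snd e") (auto simp: unpack_def NF_def tails_def N S_carrier inj_J successively_Cons)

text \<open>A tail never starts with a syllable of K, so \<open>unpack\<close> removes a syllable
  exactly when \<open>pack\<close> has added one.\<close>

lemma unpack_pack: "k \<in> carrier K \<Longrightarrow> ps \<in> tails \<Longrightarrow> unpack (pack (k, ps)) = (k, ps)"
  using rep_coef[of k] by (auto simp: unpack_def pack_def tails_def inj_J)

text \<open>By unique factorization, \<open>pack\<close> recovers the coefficient and the syllable
  that \<open>unpack\<close> has merged.\<close>

lemma pack_unpack: "e \<in> NF \<Longrightarrow> pack (unpack e) = e"
  by (cases "snd e") (auto simp: unpack_def pack_def NF_def N rep_coef_mult rep_coef_image inj_J prod_eq_iff)

lemma act_closed: "k \<in> carrier K \<Longrightarrow> e \<in> NF \<Longrightarrow> act k e \<in> NF"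
  using unpack_closed[of e] pack_closed by (auto simp: act_def)

lemma act_mult:
  assumes "k \<in> carrier K" "l \<in> carrier K" "e \<in> NF"
  shows "act k (act l e) = act (k \<otimes>\<^bsub>K\<^esub> l) e"
  using unpack_closed[OF assms(3)] assms by (auto simp: act_def unpack_pack K.m_assoc)

lemma act_one: "e \<in> NF \<Longrightarrow> act \<one>\<^bsub>K\<^esub> e = e"
  using unpack_closed[of e] pack_unpack[of e] by (auto simp: act_def)

text \<open>The result mentions neither K nor \<open>J\<close>: on elements of C both factors act by
  multiplying the coefficient. This makes the relators that identify u_i with v_i act
  trivially.\<close>

lemma act_image:
  assumes "c \<in> carrier C" "e \<in> NF"
  shows "act (\<phi> c) e = (c \<otimes>\<^bsub>C\<^esub> fst e, snd e)"
proof -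
  have "act (\<phi> c) e = pack (unpack (c \<otimes>\<^bsub>C\<^esub> fst e, snd e))"
    using assms by (cases "snd e") (auto simp: act_def unpack_def NF_def N S_carrier inj_J K.m_assoc)
  then show ?thesis using assms pack_unpack[of "(c \<otimes>\<^bsub>C\<^esub> fst e, snd e)"] by (auto simp: NF_def)
qed

text \<open>\<open>s\<close> is its own representative with coefficient 1, so no rewriting happens.
  By this a normal form is rebuilt from the empty one, syllable by syllable.\<close>

lemma act_representative:
  assumes "s \<in> S" "s \<noteq> \<one>\<^bsub>K\<^esub>" "(\<one>\<^bsub>C\<^esub>, J s # ps) \<in> NF"
  shows "act s (\<one>\<^bsub>C\<^esub>, ps) = (\<one>\<^bsub>C\<^esub>, J s # ps)"
proof -
  have "unpack (\<one>\<^bsub>C\<^esub>, ps) = (\<one>\<^bsub>K\<^esub>, ps)"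
    using assms(3) by (cases ps) (auto simp: unpack_def NF_def)
  then show ?thesis
    using assms rep_coef_mult[of "\<one>\<^bsub>C\<^esub>" s] S_carrier[OF assms(1)] by (simp add: act_def pack_def)
qed


end


section \<open>The normal form theorem for amalgamated products\<close>

locale amalgam_presentation =
  fixes X :: "'x set" and RA :: "'x word set" and Y :: "'y set" and RB :: "'y word set"
    and C :: "('c, 'm) monoid_scheme" and n :: nat and z :: "nat \<Rightarrow> 'c"
    and \<phi> :: "'c \<Rightarrow> 'x word set" and \<psi> :: "'c \<Rightarrow> 'y word set"
    and u :: "nat \<Rightarrow> 'x word" and v :: "nat \<Rightarrow> 'y word"
    and S :: "'x word set set" and T :: "'y word set set"
  assumes RA: "RA \<subseteq> words X" and RB: "RB \<subseteq> words Y"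
    and group_C: "group C" and z_carrier: "z ` {..<n} \<subseteq> carrier C"
    and generated: "carrier C = generate C (z ` {..<n})"
    and mon_phi: "\<phi> \<in> mon C (presented_group X RA)"
    and mon_psi: "\<psi> \<in> mon C (presented_group Y RB)"
    and u: "\<And>i. i < n \<Longrightarrow> u i \<in> words X \<and> pres_class X RA (u i) = \<phi> (z i)"
    and v: "\<And>i. i < n \<Longrightarrow> v i \<in> words Y \<and> pres_class Y RB (v i) = \<psi> (z i)"
    and transversal_S: "right_transversal (presented_group X RA) (\<phi> ` carrier C) S"
    and transversal_T: "right_transversal (presented_group Y RB) (\<psi> ` carrier C) T"
begin

sublocale A: presentation X RA
  by unfold_locales (rule RA)

sublocale B: presentation Y RB
  by unfold_locales (rule RB)

sublocale C: group C
  by (rule group_C)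

sublocale G: presentation "X <+> Y" "amalgam_relators RA RB n u v"
proof
  have "map (apfst Inl) ` RA \<subseteq> words (X <+> Y)" "map (apfst Inr) ` RB \<subseteq> words (X <+> Y)"
    using RA RB by auto
  moreover have "(\<lambda>i. map (apfst Inl) (u i) @ inv_word (map (apfst Inr) (v i))) ` {..<n} \<subseteq> words (X <+> Y)"
    using u v by auto
  ultimately show "amalgam_relators RA RB n u v \<subseteq> words (X <+> Y)"
    unfolding amalgam_relators_def by blast
qed

abbreviation N :: "('x word set + 'y word set) set" where
  "N \<equiv> (S - {\<one>\<^bsub>A.P\<^esub>}) <+> (T - {\<one>\<^bsub>B.P\<^esub>})"

sublocale FA: amalgam_factor C A.P \<phi> S Inl N
  by unfold_locales (auto simp: mon_phi transversal_S)

sublocale FB: amalgam_factor C B.P \<psi> T Inr N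
  by unfold_locales (auto simp: mon_psi transversal_T)

abbreviation NF :: "('c \<times> ('x word set + 'y word set) list) set" where
  "NF \<equiv> FA.NF"

lemma own_simps [simp]: "FA.own p \<longleftrightarrow> isl p" "FB.own p \<longleftrightarrow> \<not> isl p"
  by (cases p; auto)+

lemma NF_iff: "(c, ps) \<in> NF \<longleftrightarrow> c \<in> carrier C \<and> set ps \<subseteq> N \<and> successively (\<lambda>p q. isl p \<noteq> isl q) ps"
  by (simp add: FA.NF_def)

text \<open>Two tags differ in being \<open>Inl\<close> exactly when they differ in being
  \<open>Inr\<close>; hence both factors act on one and the same set.\<close>

lemma FB_NF [simp]: "FB.NF = NF"
  by (simp add: FA.NF_def FB.NF_def)

lemmas FB_act_closed = FB.act_closed[unfolded FB_NF]

text \<open>An inverse letter acts through its own class, not through the inverse of a map; that the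
  two cancel is derived later from the action laws.\<close>

definition letter_act :: "('x + 'y) \<times> bool \<Rightarrow> 'c \<times> ('x word set + 'y word set) list \<Rightarrow>
    'c \<times> ('x word set + 'y word set) list" where
  "letter_act l = (case fst l of Inl x \<Rightarrow> FA.act (A.cls [(x, snd l)]) | Inr y \<Rightarrow> FB.act (B.cls [(y, snd l)]))"

abbreviation word_act :: "('x + 'y) word \<Rightarrow> 'c \<times> ('x word set + 'y word set) list \<Rightarrow>
    'c \<times> ('x word set + 'y word set) list" where
  "word_act \<equiv> foldr letter_act"

lemma word_act_closed: "w \<in> words (X <+> Y) \<Longrightarrow> e \<in> NF \<Longrightarrow> word_act w e \<in> NF"
  by (induction w) (auto simp: letter_act_def FA.act_closed FB_act_closed)

lemma word_act_Inl:
  "w \<in> words X \<Longrightarrow> e \<in> NF \<Longrightarrow> word_act (map (apfst Inl) w) e = FA.act (A.cls w) e"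
proof (induction w)
  case Nil
  then show ?case using FA.act_one[of e] by (simp add: A.one_eq[symmetric])
next
  case (Cons l w)
  then show ?case
    using FA.act_mult[of "A.cls [l]" "A.cls w" e] by (simp add: letter_act_def)
qed

lemma word_act_Inr:
  "w \<in> words Y \<Longrightarrow> e \<in> NF \<Longrightarrow> word_act (map (apfst Inr) w) e = FB.act (B.cls w) e"
proof (induction w)
  case Nil
  then show ?case using FB.act_one[of e] by (simp add: B.one_eq[symmetric])
next
  case (Cons l w)
  then show ?case
    using FB.act_mult[of "B.cls [l]" "B.cls w" e] by (simp add: letter_act_def)
qed

text \<open>A relator of a factor represents 1 there. The relator u_i v_i^(-1) multiplies the
  coefficient first by the inverse of z_i, then by z_i.\<close>

lemma word_act_relator:
  assumes "r \<in> amalgam_relators RA RB n u v" "e \<in> NF"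
  shows "word_act r e = e"
proof -
  consider (A) w where "w \<in> RA" "r = map (apfst Inl) w" | (B) w where "w \<in> RB" "r = map (apfst Inr) w"
    | (C) i where "i < n" "r = map (apfst Inl) (u i) @ map (apfst Inr) (inv_word (v i))"
    using assms(1) unfolding amalgam_relators_def by (auto simp: inv_word_map)
  then show ?thesis
  proof cases
    case A
    then have w: "w \<in> words X" using RA by auto
    with A have "A.cls w = \<one>\<^bsub>A.P\<^esub>"
      using pres_eq.relator[of "[]" X "[]" w RA] by (simp add: A.one_eq A.cls_eq_iff)
    then show ?thesis using A w assms(2) word_act_Inl[of w e] FA.act_one[of e] by simp
  next
    case B
    then have w: "w \<in> words Y" using RB by auto
    with B have "B.cls w = \<one>\<^bsub>B.P\<^esub>"
      using pres_eq.relator[of "[]" Y "[]" w RB] by (simp add: B.one_eq B.cls_eq_iff)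
    then show ?thesis using B w assms(2) word_act_Inr[of w e] FB.act_one[of e] by simp
  next
    case C
    then have zi: "z i \<in> carrier C" using z_carrier by auto
    obtain c ps where e: "e = (c, ps)" by fastforce
    then have c: "c \<in> carrier C" using assms(2) by (simp add: NF_iff)
    have "word_act (map (apfst Inr) (inv_word (v i))) e = FB.act (\<psi> (inv\<^bsub>C\<^esub> z i)) e"
      using C v zi assms(2) by (simp add: word_act_Inr B.cls_inv)
    also have "\<dots> = (inv\<^bsub>C\<^esub> z i \<otimes>\<^bsub>C\<^esub> c, ps)"
      using zi assms(2) e by (subst FB.act_image) auto
    finally have 1: "word_act (map (apfst Inr) (inv_word (v i))) e = (inv\<^bsub>C\<^esub> z i \<otimes>\<^bsub>C\<^esub> c, ps)" .
    have nf: "(inv\<^bsub>C\<^esub> z i \<otimes>\<^bsub>C\<^esub> c, ps) \<in> NF"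
      using zi assms(2) e by (auto simp: NF_iff)
    then have "word_act r e = FA.act (\<phi> (z i)) (inv\<^bsub>C\<^esub> z i \<otimes>\<^bsub>C\<^esub> c, ps)"
      using C u 1 by (simp add: word_act_Inl)
    then show ?thesis
      using zi nf e c by (simp add: FA.act_image C.m_assoc[symmetric])
  qed
qed

lemma word_act_cancel:
  assumes "x \<in> X <+> Y" "e \<in> NF"
  shows "word_act [(x, b), (x, \<not> b)] e = e"
proof -
  have "A.cls [(a, b), (a, \<not> b)] = \<one>\<^bsub>A.P\<^esub>" if "a \<in> X" for a
    using that pres_eq.cancel[of "[]" X "[]" a RA b] by (simp add: A.one_eq A.cls_eq_iff)
  moreover have "B.cls [(a, b), (a, \<not> b)] = \<one>\<^bsub>B.P\<^esub>" if "a \<in> Y" for a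
    using that pres_eq.cancel[of "[]" Y "[]" a RB b] by (simp add: B.one_eq B.cls_eq_iff)
  ultimately show ?thesis
    \<comment> \<open>Both instances are supplied; which one applies depends on the factor of
      \<open>x\<close>, where \<open>projl\<close> or \<open>projr\<close> recovers the
      letter.\<close>
    using assms word_act_Inl[of "[(projl x, b), (projl x, \<not> b)]" e] FA.act_one[of e]
      word_act_Inr[of "[(projr x, b), (projr x, \<not> b)]" e] FB.act_one[of e]
    by auto
qed

lemma word_act_pres_eq:
  assumes "pres_eq (X <+> Y) (amalgam_relators RA RB n u v) w w'" "e \<in> NF"
  shows "word_act w e = word_act w' e"
  using assms
proof (induction arbitrary: e rule: pres_eq.induct)
  case (cancel a b x d)
  then show ?case using word_act_cancel[of x "word_act b e" d] word_act_closed[of b e] by simp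
next
  case (relator a b r)
  then show ?case using word_act_relator[of r "word_act b e"] word_act_closed[of b e] by simp
qed auto


section \<open>The canonical maps into the amalgamated product\<close>

abbreviation \<iota>A where "\<iota>A \<equiv> canon_A X RA Y RB n u v"
abbreviation \<iota>B where "\<iota>B \<equiv> canon_B X RA Y RB n u v"

lemma pres_eq_Inl:
  assumes "pres_eq X RA w w'"
  shows "pres_eq (X <+> Y) (amalgam_relators RA RB n u v) (map (apfst Inl) w) (map (apfst Inl) w')"
  using assms
proof (induction rule: pres_eq.induct)
  case (cancel a b x e)
  then show ?case
    using pres_eq.cancel[of "map (apfst Inl) a" "X <+> Y" "map (apfst Inl) b" "Inl x"] by (simp add: InlI)
next
  case (relator a b r)
  then show ?case
    using pres_eq.relator[of "map (apfst Inl) a" "X <+> Y" "map (apfst Inl) b" "map (apfst Inl) r"]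
    by (simp add: amalgam_relators_def)
qed (auto intro: pres_eq.intros)

lemma pres_eq_Inr:
  assumes "pres_eq Y RB w w'"
  shows "pres_eq (X <+> Y) (amalgam_relators RA RB n u v) (map (apfst Inr) w) (map (apfst Inr) w')"
  using assms
proof (induction rule: pres_eq.induct)
  case (cancel a b x e)
  then show ?case
    using pres_eq.cancel[of "map (apfst Inr) a" "X <+> Y" "map (apfst Inr) b" "Inr x"] by (simp add: InrI)
next
  case (relator a b r)
  then show ?case
    using pres_eq.relator[of "map (apfst Inr) a" "X <+> Y" "map (apfst Inr) b" "map (apfst Inr) r"]
    by (simp add: amalgam_relators_def)
qed (auto intro: pres_eq.intros)

lemma canon_A_cls [simp]:
  assumes "w \<in> words X"
  shows "\<iota>A (A.cls w) = G.cls (map (apfst Inl) w)"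
proof -
  have "G.cls (map (apfst Inl) w') = G.cls (map (apfst Inl) w)" if "w' \<in> A.cls w" for w'
    using that assms pres_eq_Inl[of w w'] G.cls_eq_iff[of "map (apfst Inl) w" "map (apfst Inl) w'"]
    by (simp add: pres_class_def)
  then have "\<iota>A (A.cls w) = (\<Union>w'\<in>A.cls w. G.cls (map (apfst Inl) w))"
    by (simp add: canon_A_def amalgam_class_def)
  then show ?thesis
    using A.self_in_cls[OF assms] by blast
qed

lemma canon_B_cls [simp]:
  assumes "w \<in> words Y"
  shows "\<iota>B (B.cls w) = G.cls (map (apfst Inr) w)"
proof -
  have "G.cls (map (apfst Inr) w') = G.cls (map (apfst Inr) w)" if "w' \<in> B.cls w" for w'
    using that assms pres_eq_Inr[of w w'] G.cls_eq_iff[of "map (apfst Inr) w" "map (apfst Inr) w'"]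
    by (simp add: pres_class_def)
  then have "\<iota>B (B.cls w) = (\<Union>w'\<in>B.cls w. G.cls (map (apfst Inr) w))"
    by (simp add: canon_B_def amalgam_class_def)
  then show ?thesis
    using B.self_in_cls[OF assms] by blast
qed

lemma canon_A_hom: "group_hom A.P G.P \<iota>A"
  by unfold_locales (auto simp: hom_def elim!: A.carrierE)

lemma canon_B_hom: "group_hom B.P G.P \<iota>B"
  by unfold_locales (auto simp: hom_def elim!: B.carrierE)

sublocale \<iota>A: group_hom A.P G.P \<iota>A
  by (rule canon_A_hom)

sublocale \<iota>B: group_hom B.P G.P \<iota>B
  by (rule canon_B_hom)

text \<open>On generators this is the relator for u_i and v_i, and two homomorphisms that agree on
  generators agree on C.\<close>

lemma canon_agree:
  assumes "c \<in> carrier C"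
  shows "\<iota>A (\<phi> c) = \<iota>B (\<psi> c)"
proof -
  have gen: "\<iota>A (\<phi> c) = \<iota>B (\<psi> c)" if c: "c \<in> z ` {..<n}" for c
  proof -
    obtain i where i: "i < n" "c = z i" using c by auto
    let ?a = "map (apfst Inl) (u i)" and ?b = "map (apfst Inr) (v i)"
    have "pres_eq (X <+> Y) (amalgam_relators RA RB n u v) ([] @ (?a @ inv_word ?b) @ []) ([] @ [])"
      using i by (intro pres_eq.relator) (auto simp: amalgam_relators_def)
    then have "G.cls ?a \<otimes>\<^bsub>G.P\<^esub> G.cls (inv_word ?b) = \<one>\<^bsub>G.P\<^esub>"
      using i u v by (simp add: G.one_eq G.cls_eq_iff)
    then have "G.cls ?a \<otimes>\<^bsub>G.P\<^esub> inv\<^bsub>G.P\<^esub> G.cls ?b = \<one>\<^bsub>G.P\<^esub>"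
      using i u v by (simp add: G.cls_inv)
    then have "G.cls ?a = G.cls ?b"
      using i u v G.inv_equality[of "G.cls ?a" "inv\<^bsub>G.P\<^esub> G.cls ?b"] by simp
    then show ?thesis
      using i u v canon_A_cls[of "u i"] canon_B_cls[of "v i"] by simp
  qed
  have "c \<in> generate C (z ` {..<n})" using assms generated by simp
  then show ?thesis
  proof (induction rule: generate.induct)
    case (incl h)
    then show ?case by (rule gen)
  next
    case (inv h)
    then have "h \<in> carrier C" using z_carrier by auto
    then show ?case using gen[OF inv] by simp
  next
    case (eng h1 h2)
    then show ?case by (simp add: generated[symmetric])
  qed simp
qed

section \<open>Values of formal expressions and their uniqueness\<close>

abbreviation syllable_value :: "'x word set + 'y word set \<Rightarrow> ('x + 'y) word set" where
  "syllable_value \<equiv> case_sum \<iota>A \<iota>B"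

definition expression_value :: "'c \<times> ('x word set + 'y word set) list \<Rightarrow> ('x + 'y) word set" where
  "expression_value e = \<iota>A (\<phi> (fst e)) \<otimes>\<^bsub>G.P\<^esub> foldr (\<otimes>\<^bsub>G.P\<^esub>) (map syllable_value (snd e)) \<one>\<^bsub>G.P\<^esub>"

lemma syllable_value_closed: "p \<in> N \<Longrightarrow> syllable_value p \<in> carrier G.P"
  using FA.S_carrier FB.S_carrier by auto

text \<open>The same word must name the value in G and rebuild the list from the empty normal form.
  The coefficient is kept 1 because \<open>act_representative\<close> requires it; a general one is
  put in front afterwards by \<open>act_image\<close>.\<close>

lemma word_of_syllables:
  "(\<one>\<^bsub>C\<^esub>, ps) \<in> NF \<Longrightarrow> \<exists>w\<in>words (X <+> Y). G.cls w = foldr (\<otimes>\<^bsub>G.P\<^esub>) (map syllable_value ps) \<one>\<^bsub>G.P\<^esub> \<and>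
     word_act w (\<one>\<^bsub>C\<^esub>, []) = (\<one>\<^bsub>C\<^esub>, ps)"
proof (induction ps)
  case Nil
  then show ?case by (intro bexI[of _ "[]"]) (auto simp: G.one_eq)
next
  case (Cons p ps)
  then have nf: "(\<one>\<^bsub>C\<^esub>, ps) \<in> NF" by (cases ps) (auto simp: NF_iff)
  with Cons obtain w where w: "w \<in> words (X <+> Y)"
    "G.cls w = foldr (\<otimes>\<^bsub>G.P\<^esub>) (map syllable_value ps) \<one>\<^bsub>G.P\<^esub>" "word_act w (\<one>\<^bsub>C\<^esub>, []) = (\<one>\<^bsub>C\<^esub>, ps)"
    by blast
  show ?case
  proof (cases p)
    case (Inl s)
    then have s: "s \<in> S" "s \<noteq> \<one>\<^bsub>A.P\<^esub>" using Cons.prems by (auto simp: NF_iff)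
    obtain a where a: "a \<in> words X" "s = A.cls a"
      using FA.S_carrier[OF s(1)] by (rule A.carrierE)
    show ?thesis
      using w a s nf Inl FA.act_representative[OF s] Cons.prems G.cls_mult[of "map (apfst Inl) a" w]
      by (intro bexI[of _ "map (apfst Inl) a @ w"]) (auto simp: word_act_Inl)
  next
    case (Inr s)
    then have s: "s \<in> T" "s \<noteq> \<one>\<^bsub>B.P\<^esub>" using Cons.prems by (auto simp: NF_iff)
    obtain a where a: "a \<in> words Y" "s = B.cls a"
      using FB.S_carrier[OF s(1)] by (rule B.carrierE)
    show ?thesis
      using w a s nf Inr FB.act_representative[OF s] Cons.prems G.cls_mult[of "map (apfst Inr) a" w]
      by (intro bexI[of _ "map (apfst Inr) a @ w"]) (auto simp: word_act_Inr)
  qed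
qed

lemma word_of_expression:
  assumes "e \<in> NF"
  shows "\<exists>w\<in>words (X <+> Y). G.cls w = expression_value e \<and> word_act w (\<one>\<^bsub>C\<^esub>, []) = e"
proof -
  obtain c ps where e: "e = (c, ps)" by fastforce
  with assms have c: "c \<in> carrier C" and nf: "(\<one>\<^bsub>C\<^esub>, ps) \<in> NF" by (auto simp: NF_iff)
  from word_of_syllables[OF nf] obtain w where w: "w \<in> words (X <+> Y)"
    "G.cls w = foldr (\<otimes>\<^bsub>G.P\<^esub>) (map syllable_value ps) \<one>\<^bsub>G.P\<^esub>" "word_act w (\<one>\<^bsub>C\<^esub>, []) = (\<one>\<^bsub>C\<^esub>, ps)"
    by blast
  obtain a where a: "a \<in> words X" "\<phi> c = A.cls a"
    using FA.\<phi>.hom_closed[OF c] by (rule A.carrierE)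
  show ?thesis
    using w a e c nf FA.act_image[OF c nf] G.cls_mult[of "map (apfst Inl) a" w]
    by (intro bexI[of _ "map (apfst Inl) a @ w"]) (auto simp: word_act_Inl expression_value_def)
qed

lemma expression_unique:
  assumes "e \<in> NF" "e' \<in> NF" "expression_value e = expression_value e'"
  shows "e = e'"
proof -
  obtain w w' where w: "w \<in> words (X <+> Y)" "G.cls w = expression_value e" "word_act w (\<one>\<^bsub>C\<^esub>, []) = e"
    and w': "w' \<in> words (X <+> Y)" "G.cls w' = expression_value e'" "word_act w' (\<one>\<^bsub>C\<^esub>, []) = e'"
    using word_of_expression assms(1,2) by meson
  then have "pres_eq (X <+> Y) (amalgam_relators RA RB n u v) w w'"
    using assms(3) by (simp add: G.cls_eq_iff[symmetric])
  from word_act_pres_eq[OF this, of "(\<one>\<^bsub>C\<^esub>, [])"] w w' show ?thesis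
    by (simp add: NF_iff)
qed

text \<open>Otherwise a one-syllable expression and the empty one would have the same value.\<close>

lemma syllable_value_nontrivial:
  assumes "p \<in> N"
  shows "syllable_value p \<noteq> \<one>\<^bsub>G.P\<^esub>"
proof
  assume "syllable_value p = \<one>\<^bsub>G.P\<^esub>"
  then have "expression_value (\<one>\<^bsub>C\<^esub>, [p]) = expression_value (\<one>\<^bsub>C\<^esub>, [])"
    by (simp add: expression_value_def)
  then show False
    using expression_unique[of "(\<one>\<^bsub>C\<^esub>, [p])" "(\<one>\<^bsub>C\<^esub>, [])"] assms by (simp add: NF_iff)
qed

text \<open>Splitting off the representative leaves at most one syllable, tagged by A. Used to keep
  nontrivial representatives from T out of A.\<close>

lemma factor_A_expression:
  assumes "a \<in> carrier A.P"
  shows "\<exists>e\<in>NF. \<iota>A a = expression_value e \<and> (\<forall>p\<in>set (snd e). isl p)"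
proof -
  note r = FA.rep_coef[OF assms]
  let ?e = "FA.pack (a, [])"
  have "\<iota>A a = \<iota>A (\<phi> (FA.coef a) \<otimes>\<^bsub>A.P\<^esub> FA.rep a)"
    using r(3) by simp
  also have "\<dots> = expression_value ?e"
    using r(1,2) FA.S_carrier[of "FA.rep a"] by (auto simp: expression_value_def FA.pack_def)
  finally have "\<iota>A a = expression_value ?e" .
  moreover have "?e \<in> NF" using assms by (intro FA.pack_closed) (auto simp: FA.tails_def)
  ultimately show ?thesis by (intro bexI[of _ ?e]) (auto simp: FA.pack_def)
qed

lemma factor_B_expression:
  assumes "b \<in> carrier B.P"
  shows "\<exists>e\<in>NF. \<iota>B b = expression_value e \<and> (\<forall>p\<in>set (snd e). \<not> isl p)"
proof -
  note r = FB.rep_coef[OF assms]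
  let ?e = "FB.pack (b, [])"
  have "\<iota>B b = \<iota>B (\<psi> (FB.coef b) \<otimes>\<^bsub>B.P\<^esub> FB.rep b)"
    using r(3) by simp
  also have "\<dots> = expression_value ?e"
    using r(1,2) FB.S_carrier[of "FB.rep b"]
    by (auto simp: expression_value_def FB.pack_def canon_agree)
  finally have "\<iota>B b = expression_value ?e" .
  moreover have "?e \<in> NF" using FB.pack_closed[of b "[]"] assms by (auto simp: FB.tails_def)
  ultimately show ?thesis by (intro bexI[of _ ?e]) (auto simp: FB.pack_def)
qed

lemma single_expression:
  assumes "p \<in> N"
  shows "syllable_value p = expression_value (\<one>\<^bsub>C\<^esub>, [p])" "(\<one>\<^bsub>C\<^esub>, [p]) \<in> NF"
  using syllable_value_closed[OF assms] assms by (auto simp: expression_value_def NF_iff)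

text \<open>An element of B has an expression without \<open>Inl\<close> syllables, whereas
  \<open>[Inl s]\<close> gives another expression of the same element; uniqueness excludes
  this.\<close>

lemma syllable_A_notin_B:
  assumes "Inl s \<in> N"
  shows "\<iota>A s \<notin> \<iota>B ` carrier B.P"
proof
  assume "\<iota>A s \<in> \<iota>B ` carrier B.P"
  then obtain e where "e \<in> NF" "\<iota>A s = expression_value e" "\<forall>p\<in>set (snd e). \<not> isl p"
    using factor_B_expression by force
  with expression_unique[of "(\<one>\<^bsub>C\<^esub>, [Inl s])" e] single_expression[OF assms] show False by auto
qed

lemma syllable_B_notin_A:
  assumes "Inr t \<in> N"
  shows "\<iota>B t \<notin> \<iota>A ` carrier A.P"
proof
  assume "\<iota>B t \<in> \<iota>A ` carrier A.P"
  then obtain e where "e \<in> NF" "\<iota>B t = expression_value e" "\<forall>p\<in>set (snd e). isl p"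
    using factor_A_expression by force
  with expression_unique[of "(\<one>\<^bsub>C\<^esub>, [Inr t])" e] single_expression[OF assms] show False by auto
qed

section \<open>Formal expressions and normal expressions in G\<close>

abbreviation normal_expr where
  "normal_expr \<equiv> normal_expression G.P (\<iota>A ` carrier A.P) (\<iota>B ` carrier B.P) (\<iota>A ` \<phi> ` carrier C) (\<iota>A ` S) (\<iota>B ` T)"

text \<open>Different tags meet the membership form of alternation because a nontrivial
  representative lies in its own factor only.\<close>

lemma normal_expressionI:
  assumes "(c, ps) \<in> NF"
  shows "normal_expr (expression_value (c, ps)) (\<iota>A (\<phi> c), map syllable_value ps)"
proof -
  have N: "set ps \<subseteq> N" and alt: "successively (\<lambda>p q. isl p \<noteq> isl q) ps" and c: "c \<in> carrier C"
    using assms by (auto simp: NF_iff)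
  have alt': "successively (\<lambda>p q. \<not> (syllable_value p \<in> \<iota>A ` carrier A.P \<and> syllable_value q \<in> \<iota>A ` carrier A.P) \<and>
     \<not> (syllable_value p \<in> \<iota>B ` carrier B.P \<and> syllable_value q \<in> \<iota>B ` carrier B.P)) ps"
  proof (rule successively_mono[OF alt])
    fix p q assume "p \<in> set ps" "q \<in> set ps" "isl p \<noteq> isl q"
    with N have "p \<in> N" "q \<in> N" by auto
    with \<open>isl p \<noteq> isl q\<close> syllable_A_notin_B syllable_B_notin_A
    show "\<not> (syllable_value p \<in> \<iota>A ` carrier A.P \<and> syllable_value q \<in> \<iota>A ` carrier A.P) \<and>
     \<not> (syllable_value p \<in> \<iota>B ` carrier B.P \<and> syllable_value q \<in> \<iota>B ` carrier B.P)"
      by (cases p; cases q) auto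
  qed
  have "syllable_value p \<in> (\<iota>A ` S \<union> \<iota>B ` T) - {\<one>\<^bsub>G.P\<^esub>}" if "p \<in> set ps" for p
  proof -
    have "p \<in> N" using that N by blast
    moreover from this have "syllable_value p \<in> \<iota>A ` S \<union> \<iota>B ` T" by auto
    ultimately show ?thesis using syllable_value_nontrivial[of p] by blast
  qed
  then have "set (map syllable_value ps) \<subseteq> (\<iota>A ` S \<union> \<iota>B ` T) - {\<one>\<^bsub>G.P\<^esub>}"
    unfolding set_map by (rule image_subsetI)
  with alt' show ?thesis
    using c by (simp add: normal_expression_def successively_map expression_value_def)
qed

text \<open>Tags are put back by choosing a tagged preimage of each syllable. Equal tags would place
  neighbouring syllables in a common factor, which the definition forbids.\<close>

lemma normal_expressionE:
  assumes "normal_expr g e"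
  obtains c ps where "(c, ps) \<in> NF" "e = (\<iota>A (\<phi> c), map syllable_value ps)" "g = expression_value (c, ps)"
proof -
  obtain d qs where e: "e = (d, qs)" by fastforce
  from assms obtain c where c: "c \<in> carrier C" "d = \<iota>A (\<phi> c)"
    by (auto simp: normal_expression_def e)
  have qs: "set qs \<subseteq> (\<iota>A ` S \<union> \<iota>B ` T) - {\<one>\<^bsub>G.P\<^esub>}"
    and alt: "successively (\<lambda>p q. \<not> (p \<in> \<iota>A ` carrier A.P \<and> q \<in> \<iota>A ` carrier A.P) \<and>
     \<not> (p \<in> \<iota>B ` carrier B.P \<and> q \<in> \<iota>B ` carrier B.P)) qs"
    and g: "g = d \<otimes>\<^bsub>G.P\<^esub> foldr (\<otimes>\<^bsub>G.P\<^esub>) qs \<one>\<^bsub>G.P\<^esub>"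
    using assms by (auto simp: normal_expression_def e)
  have "\<exists>p\<in>N. syllable_value p = q" if q: "q \<in> set qs" for q
  proof -
    from q qs consider s where "s \<in> S" "q = \<iota>A s" "q \<noteq> \<one>\<^bsub>G.P\<^esub>" | t where "t \<in> T" "q = \<iota>B t" "q \<noteq> \<one>\<^bsub>G.P\<^esub>"
      by blast
    then show ?thesis
    proof cases
      case 1 then show ?thesis by (intro bexI[of _ "Inl s"]) auto
    next
      case 2 then show ?thesis by (intro bexI[of _ "Inr t"]) auto
    qed
  qed
  then obtain h where h: "\<And>q. q \<in> set qs \<Longrightarrow> h q \<in> N" "\<And>q. q \<in> set qs \<Longrightarrow> syllable_value (h q) = q"
    by metis
  have "successively (\<lambda>p q. isl (h p) \<noteq> isl (h q)) qs"
  proof (rule successively_mono[OF alt])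
    fix p q assume "p \<in> set qs" "q \<in> set qs" "\<not> (p \<in> \<iota>A ` carrier A.P \<and> q \<in> \<iota>A ` carrier A.P) \<and>
     \<not> (p \<in> \<iota>B ` carrier B.P \<and> q \<in> \<iota>B ` carrier B.P)"
    with h[of p] h[of q] show "isl (h p) \<noteq> isl (h q)"
      using FA.S_carrier FB.S_carrier by (cases "h p"; cases "h q") auto
  qed
  then have "(c, map h qs) \<in> NF"
    using c h(1) by (auto simp: NF_iff successively_map)
  moreover have "map syllable_value (map h qs) = qs"
    using h(2) by (simp add: map_idI)
  ultimately show thesis
    using that[of c "map h qs"] e g c(2) by (simp add: expression_value_def del: map_map)
qed

lemma normal_form:
  assumes "(c, ps) \<in> NF"
  shows "is_normal_form G.P (\<iota>A ` carrier A.P) (\<iota>B ` carrier B.P) (\<iota>A ` \<phi> ` carrier C) (\<iota>A ` S) (\<iota>B ` T)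
    (expression_value (c, ps)) (\<iota>A (\<phi> c), map syllable_value ps)"
  unfolding is_normal_form_def
proof (intro conjI allI impI)
  fix e assume "normal_expr (expression_value (c, ps)) e"
  then obtain d qs where "(d, qs) \<in> NF" "e = (\<iota>A (\<phi> d), map syllable_value qs)"
    "expression_value (c, ps) = expression_value (d, qs)"
    by (rule normal_expressionE)
  then show "e = (\<iota>A (\<phi> c), map syllable_value ps)"
    using expression_unique[OF assms, of "(d, qs)"] by simp
qed (rule normal_expressionI[OF assms])

end


section \<open>Correctness of the algorithm\<close>

lemma join_eq_None_iff: "join p q = None \<longleftrightarrow> isl p \<noteq> isl q"
  by (cases p; cases q) auto

text \<open>Once the guard fails, the guarded step is stationary, so surplus rounds do no harm and
  any bound on the measure may serve as number of rounds.\<close>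

lemma while_option_funpow:
  fixes f :: "'s \<Rightarrow> nat"
  assumes "\<And>s. b s \<Longrightarrow> f (c s) < f s" "f s \<le> k"
  shows "while_option b c s = Some (((\<lambda>s. if b s then c s else s) ^^ k) s)"
  using assms(2)
proof (induction k arbitrary: s)
  case 0
  then show ?case using assms(1)[of s] by (subst while_option_unfold) auto
next
  case (Suc k)
  show ?case
  proof (cases "b s")
    case True
    then show ?thesis
      using Suc assms(1)[OF True] by (subst while_option_unfold) (simp add: funpow_Suc_right del: funpow.simps)
  next
    case False
    then have "((\<lambda>s. if b s then c s else s) ^^ m) s = s" for m
      by (induction m) auto
    with False show ?thesis by (subst while_option_unfold) simp
  qed
qed

lemma foldl_ignore: "foldl (\<lambda>s _. h s) s xs = (h ^^ length xs) s"
  by (induction xs arbitrary: s) (auto simp: funpow_swap1)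

text \<open>As \<open>r w\<close> represents an element of the coset H w, the element w (r w)^(-1)
  belongs to H; hence the membership search cannot fail, and its answer is the coefficient.\<close>

lemma (in presentation) search_decomposition:
  assumes m: "solves_membership_search X R H n u m" and r: "solves_coset_rep_search X R H S r"
    and H: "subgroup H P" and S: "S \<subseteq> words X" and w: "w \<in> words X"
  obtains c where "m (w @ inv_word (r w)) = Some c" "c \<in> words {..<n}" "r w \<in> S"
    "cls (subst_word u c) \<otimes>\<^bsub>P\<^esub> cls (r w) = cls w"
proof -
  have rw: "r w \<in> S" "cls (r w) \<in> H #>\<^bsub>P\<^esub> cls w"
    using r w by (auto simp: solves_coset_rep_search_def)
  then have rw': "r w \<in> words X" using S by blast
  obtain h where h: "h \<in> H" "cls (r w) = h \<otimes>\<^bsub>P\<^esub> cls w"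
    using rw(2) by (auto simp: r_coset_def)
  have hP: "h \<in> carrier P" using h(1) H subgroup.subset by blast
  let ?w = "w @ inv_word (r w)"
  have "cls ?w = cls w \<otimes>\<^bsub>P\<^esub> inv\<^bsub>P\<^esub> (h \<otimes>\<^bsub>P\<^esub> cls w)"
    using w rw' by (simp add: cls_mult[symmetric] cls_inv h(2) del: cls_mult)
  also have "\<dots> = inv\<^bsub>P\<^esub> h"
    using w hP by (simp add: inv_mult_group m_assoc[symmetric])
  finally have H': "cls ?w \<in> H" using h(1) H by (simp add: subgroup.m_inv_closed)
  have "case m ?w of None \<Rightarrow> cls ?w \<notin> H | Some c \<Rightarrow> cls ?w \<in> H \<and> c \<in> words {..<n} \<and> cls (subst_word u c) = cls ?w"
    using m w rw' by (simp add: solves_membership_search_def)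
  with H' obtain c where c: "m ?w = Some c" "c \<in> words {..<n}" "cls (subst_word u c) = cls ?w"
    by (auto split: option.splits)
  have "cls (subst_word u c) \<otimes>\<^bsub>P\<^esub> cls (r w) = cls w \<otimes>\<^bsub>P\<^esub> (inv\<^bsub>P\<^esub> cls (r w) \<otimes>\<^bsub>P\<^esub> cls (r w))"
    using w rw' by (simp add: c(3) cls_mult[symmetric] cls_inv m_assoc del: cls_mult)
  then show thesis
    using that c rw(1) w rw' by simp
qed

lemma membership_iff:
  assumes "solves_membership_search X R H n u m" "w \<in> words X"
  shows "m w \<noteq> None \<longleftrightarrow> pres_class X R w \<in> H"
  using assms by (force simp: solves_membership_search_def split: option.splits)

context amalgam_presentation
begin

definition word_value :: "nat word \<Rightarrow> 'c" where
  "word_value c = foldr (\<lambda>(i, e) d. (if e then z i else inv\<^bsub>C\<^esub> z i) \<otimes>\<^bsub>C\<^esub> d) c \<one>\<^bsub>C\<^esub>"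

text \<open>This justifies substituting v_j for u_j: both substituted words represent images of one
  element of the abstract group C.\<close>

lemma word_value:
  assumes "c \<in> words {..<n}"
  shows "word_value c \<in> carrier C" "A.cls (subst_word u c) = \<phi> (word_value c)"
    "B.cls (subst_word v c) = \<psi> (word_value c)"
  using assms
proof (induction c)
  case Nil
  {
    case 1 then show ?case by (simp add: word_value_def)
  next
    case 2 then show ?case by (simp add: word_value_def A.one_eq[symmetric])
  next
    case 3 then show ?case by (simp add: word_value_def B.one_eq[symmetric])
  }
next
  case (Cons l c)
  have eq: "word_value (l # c) = (if snd l then z (fst l) else inv\<^bsub>C\<^esub> z (fst l)) \<otimes>\<^bsub>C\<^esub> word_value c"
    by (simp add: word_value_def case_prod_unfold)
  {
    case 1 then show ?case using Cons.IH z_carrier by (auto simp: eq)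
  next
    case 2
    then have "z (fst l) \<in> carrier C" "subst_word u c \<in> words X"
      using z_carrier u subst_word_in_words[of n u X c] by auto
    with 2 show ?case using Cons.IH u[of "fst l"]
      by (auto simp: eq A.cls_inv A.cls_mult[symmetric] simp del: A.cls_mult)
  next
    case 3
    then have "z (fst l) \<in> carrier C" "subst_word v c \<in> words Y"
      using z_carrier v subst_word_in_words[of n v Y c] by auto
    with 3 show ?case using Cons.IH v[of "fst l"]
      by (auto simp: eq B.cls_inv B.cls_mult[symmetric] simp del: B.cls_mult)
  }
qed

lemma subst_words: "c \<in> words {..<n} \<Longrightarrow> subst_word u c \<in> words X" "c \<in> words {..<n} \<Longrightarrow> subst_word v c \<in> words Y"
  using u v subst_word_in_words by blast+

section \<open>Values of coefficients and syllables in G\<close>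

abbreviation coeff_value :: "nat word \<Rightarrow> ('x + 'y) word set" where
  "coeff_value c \<equiv> G.cls (map (apfst Inl) (subst_word u c))"

lemma coeff_value:
  assumes "c \<in> words {..<n}"
  shows "coeff_value c = \<iota>A (\<phi> (word_value c))" "coeff_value c = \<iota>A (A.cls (subst_word u c))"
    "coeff_value c = \<iota>B (B.cls (subst_word v c))"
  using assms canon_A_cls[of "subst_word u c"] canon_agree[of "word_value c"]
  by (simp_all add: word_value subst_words)

text \<open>Concatenation in \<open>absorb\<close> and \<open>join\<close> is not followed by free
  reduction, so intermediate syllables are arbitrary words over their alphabets.\<close>

definition syllables :: "('x, 'y) syllable set" where
  "syllables = words X <+> words Y"

abbreviation gval :: "('x, 'y) syllable \<Rightarrow> ('x + 'y) word set" where
  "gval s \<equiv> G.cls (syl_word s)"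

definition gvals :: "('x, 'y) syllable list \<Rightarrow> ('x + 'y) word set" where
  "gvals gs = G.cls (concat (map syl_word gs))"

lemma syl_word_in_words: "s \<in> syllables \<Longrightarrow> syl_word s \<in> words (X <+> Y)"
  by (auto simp: syllables_def)

lemma concat_in_words: "set gs \<subseteq> syllables \<Longrightarrow> concat (map syl_word gs) \<in> words (X <+> Y)"
  by (induction gs) (auto simp: syl_word_in_words)

lemma gvals_simps:
  "gvals [] = \<one>\<^bsub>G.P\<^esub>"
  "s \<in> syllables \<Longrightarrow> set gs \<subseteq> syllables \<Longrightarrow> gvals (s # gs) = gval s \<otimes>\<^bsub>G.P\<^esub> gvals gs"
  "s \<in> syllables \<Longrightarrow> set gs \<subseteq> syllables \<Longrightarrow> gvals (gs @ [s]) = gvals gs \<otimes>\<^bsub>G.P\<^esub> gval s"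
  by (simp_all add: gvals_def G.one_eq syl_word_in_words concat_in_words)

lemma values_closed:
  "c \<in> words {..<n} \<Longrightarrow> coeff_value c \<in> carrier G.P"
  "s \<in> syllables \<Longrightarrow> gval s \<in> carrier G.P"
  "set gs \<subseteq> syllables \<Longrightarrow> gvals gs \<in> carrier G.P"
  by (simp_all add: gvals_def syl_word_in_words concat_in_words subst_words)

text \<open>c(u) and c(v) are equal in G, so c may be appended in either factor, or to the leading
  coefficient when no syllable is left.\<close>

lemma absorb_correct:
  assumes "c \<in> words {..<n}" "c1 \<in> words {..<n}" "set gs \<subseteq> syllables" "absorb u v c (c1, gs) = (c1', gs')"
  shows "c1' \<in> words {..<n}" "set gs' \<subseteq> syllables"
    "coeff_value c1' \<otimes>\<^bsub>G.P\<^esub> gvals gs' = coeff_value c1 \<otimes>\<^bsub>G.P\<^esub> gvals gs \<otimes>\<^bsub>G.P\<^esub> coeff_value c"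
proof -
  have "c1' \<in> words {..<n} \<and> set gs' \<subseteq> syllables \<and>
    coeff_value c1' \<otimes>\<^bsub>G.P\<^esub> gvals gs' = coeff_value c1 \<otimes>\<^bsub>G.P\<^esub> gvals gs \<otimes>\<^bsub>G.P\<^esub> coeff_value c"
  proof (cases gs rule: rev_cases)
    case Nil
    with assms show ?thesis
      by (auto simp: absorb_def gvals_simps subst_words)
  next
    case (snoc hs s)
    define s' where "s' = (case s of Inl w \<Rightarrow> Inl (w @ subst_word u c) | Inr w \<Rightarrow> Inr (w @ subst_word v c))"
    have eq: "c1' = c1" "gs' = hs @ [s']"
      using assms(4) by (auto simp: snoc absorb_def s'_def)
    have s: "s \<in> syllables" "set hs \<subseteq> syllables" using assms(3) by (auto simp: snoc)
    have s': "s' \<in> syllables \<and> gval s' = gval s \<otimes>\<^bsub>G.P\<^esub> coeff_value c"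
    proof (cases s)
      case (Inl w)
      then have "w \<in> words X" using s(1) by (auto simp: syllables_def)
      then show ?thesis
        using assms(1) by (simp add: Inl s'_def syllables_def InlI subst_words)
    next
      case (Inr w)
      then have "w \<in> words Y" using s(1) by (auto simp: syllables_def)
      then show ?thesis
        \<comment> \<open>\<open>coeff_value\<close> is defined with the words u_i; for a syllable
          of B it is read through the words v_i.\<close>
        using assms(1) unfolding coeff_value(3)[OF assms(1)]
        by (simp add: Inr s'_def syllables_def InrI subst_words)
    qed
    show ?thesis
      using s s' assms(1,2) by (simp add: eq snoc gvals_simps values_closed G.m_assoc)
  qed
  then show "c1' \<in> words {..<n}" "set gs' \<subseteq> syllables"
    "coeff_value c1' \<otimes>\<^bsub>G.P\<^esub> gvals gs' = coeff_value c1 \<otimes>\<^bsub>G.P\<^esub> gvals gs \<otimes>\<^bsub>G.P\<^esub> coeff_value c"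
    by auto
qed

lemma join_correct:
  assumes "p \<in> syllables" "q \<in> syllables" "join p q = Some s"
  shows "s \<in> syllables" "isl s = isl q" "isl s = isl p" "gval s = gval p \<otimes>\<^bsub>G.P\<^esub> gval q"
  using assms by (cases p; cases q; auto simp: syllables_def)+

end

text \<open>Here S and T are sets of words; several words of S may represent the same element of the
  transversal.\<close>

locale search_algorithms =
  amalgam_presentation X RA Y RB C n z \<phi> \<psi> u v "pres_class X RA ` S" "pres_class Y RB ` T"
  for X :: "'x set" and RA :: "'x word set" and Y :: "'y set" and RB :: "'y word set"
    and C :: "('c, 'm) monoid_scheme" and n :: nat and z :: "nat \<Rightarrow> 'c"
    and \<phi> :: "'c \<Rightarrow> 'x word set" and \<psi> :: "'c \<Rightarrow> 'y word set"
    and u :: "nat \<Rightarrow> 'x word" and v :: "nat \<Rightarrow> 'y word"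
    and S :: "'x word set" and T :: "'y word set" +
  fixes mA :: "'x word \<Rightarrow> nat word option" and rA :: "'x word \<Rightarrow> 'x word"
    and mB :: "'y word \<Rightarrow> nat word option" and rB :: "'y word \<Rightarrow> 'y word"
  assumes finite_X: "finite X" and finite_Y: "finite Y"
    and S_words: "S \<subseteq> words X" and T_words: "T \<subseteq> words Y"
    and mA: "solves_membership_search X RA (\<phi> ` carrier C) n u mA"
    and rA: "solves_coset_rep_search X RA (\<phi> ` carrier C) S rA"
    and mB: "solves_membership_search Y RB (\<psi> ` carrier C) n v mB"
    and rB: "solves_coset_rep_search Y RB (\<psi> ` carrier C) T rB"
begin

abbreviation "split \<equiv> split_syl mA rA mB rB"
abbreviation "trivial \<equiv> trivial_rep mA mB"
abbreviation "step \<equiv> algorithm_II_step mA rA mB rB u v"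

lemma representatives_syllables: "p \<in> S <+> T \<Longrightarrow> p \<in> syllables"
  using S_words T_words by (auto simp: syllables_def)

lemma split_correct:
  assumes "s \<in> syllables" "split s = (c, p)"
  shows "c \<in> words {..<n}" "p \<in> S <+> T" "isl p = isl s"
    "gval s = coeff_value c \<otimes>\<^bsub>G.P\<^esub> gval p"
proof -
  have "c \<in> words {..<n} \<and> p \<in> S <+> T \<and> isl p = isl s \<and> gval s = coeff_value c \<otimes>\<^bsub>G.P\<^esub> gval p"
  proof (cases s)
    case (Inl w)
    then have w: "w \<in> words X" using assms(1) by (auto simp: syllables_def)
    obtain d where d: "mA (w @ inv_word (rA w)) = Some d" "d \<in> words {..<n}" "rA w \<in> S"
      "A.cls (subst_word u d) \<otimes>\<^bsub>A.P\<^esub> A.cls (rA w) = A.cls w"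
      using A.search_decomposition[OF mA rA FA.image_subgroup S_words w] .
    have rw: "rA w \<in> words X" using d(3) S_words by blast
    have "gval s = \<iota>A (A.cls (subst_word u d) \<otimes>\<^bsub>A.P\<^esub> A.cls (rA w))"
      using w unfolding d(4) by (simp add: Inl)
    also have "\<dots> = coeff_value d \<otimes>\<^bsub>G.P\<^esub> gval (Inl (rA w))"
      using rw d(2) by (simp add: subst_words)
    finally show ?thesis using assms(2) d by (auto simp: Inl)
  next
    case (Inr w)
    then have w: "w \<in> words Y" using assms(1) by (auto simp: syllables_def)
    obtain d where d: "mB (w @ inv_word (rB w)) = Some d" "d \<in> words {..<n}" "rB w \<in> T"
      "B.cls (subst_word v d) \<otimes>\<^bsub>B.P\<^esub> B.cls (rB w) = B.cls w"
      using B.search_decomposition[OF mB rB FB.image_subgroup T_words w] .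
    have rw: "rB w \<in> words Y" using d(3) T_words by blast
    have "gval s = \<iota>B (B.cls (subst_word v d) \<otimes>\<^bsub>B.P\<^esub> B.cls (rB w))"
      using w unfolding d(4) by (simp add: Inr)
    also have "\<dots> = coeff_value d \<otimes>\<^bsub>G.P\<^esub> gval (Inr (rB w))"
      using rw d(2) by (simp add: subst_words coeff_value(3))
    finally show ?thesis using assms(2) d by (auto simp: Inr)
  qed
  then show "c \<in> words {..<n}" "p \<in> S <+> T" "isl p = isl s"
    "gval s = coeff_value c \<otimes>\<^bsub>G.P\<^esub> gval p"
    by auto
qed

text \<open>An element of the transversal is its own representative, and every element of C has
  representative 1; so a representative lying in C equals 1.\<close>

lemma trivial_iff:
  assumes "p \<in> S <+> T"
  shows "trivial p \<longleftrightarrow> map_sum A.cls B.cls p \<notin> N"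
proof (cases p)
  case (Inl w)
  then have w: "w \<in> S" "w \<in> words X" using assms S_words by auto
  have "A.cls w \<in> \<phi> ` carrier C \<longleftrightarrow> A.cls w = \<one>\<^bsub>A.P\<^esub>"
  proof
    assume "A.cls w \<in> \<phi> ` carrier C"
    then obtain c where c: "c \<in> carrier C" "A.cls w = \<phi> c" by blast
    have "FA.rep (A.cls w) = A.cls w"
      using FA.rep_coef_mult(1)[of "\<one>\<^bsub>C\<^esub>" "A.cls w"] w by simp
    then show "A.cls w = \<one>\<^bsub>A.P\<^esub>"
      using FA.rep_coef_image(1)[of c] c by simp
  next
    assume "A.cls w = \<one>\<^bsub>A.P\<^esub>"
    then show "A.cls w \<in> \<phi> ` carrier C" using subgroup.one_closed[OF FA.image_subgroup] by simp
  qed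
  then show ?thesis using w membership_iff[OF mA w(2)] by (auto simp: Inl)
next
  case (Inr w)
  then have w: "w \<in> T" "w \<in> words Y" using assms T_words by auto
  have "B.cls w \<in> \<psi> ` carrier C \<longleftrightarrow> B.cls w = \<one>\<^bsub>B.P\<^esub>"
  proof
    assume "B.cls w \<in> \<psi> ` carrier C"
    then obtain c where c: "c \<in> carrier C" "B.cls w = \<psi> c" by blast
    have "FB.rep (B.cls w) = B.cls w"
      using FB.rep_coef_mult(1)[of "\<one>\<^bsub>C\<^esub>" "B.cls w"] w by simp
    then show "B.cls w = \<one>\<^bsub>B.P\<^esub>"
      using FB.rep_coef_image(1)[of c] c by simp
  next
    assume "B.cls w = \<one>\<^bsub>B.P\<^esub>"
    then show "B.cls w \<in> \<psi> ` carrier C" using subgroup.one_closed[OF FB.image_subgroup] by simp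
  qed
  then show ?thesis using w membership_iff[OF mB w(2)] by (auto simp: Inr)
qed

lemma gval_eq_syllable_value: "p \<in> syllables \<Longrightarrow> syllable_value (map_sum A.cls B.cls p) = gval p"
  by (auto simp: syllables_def)

lemma trivial_gval:
  assumes "p \<in> S <+> T" "trivial p"
  shows "gval p = \<one>\<^bsub>G.P\<^esub>"
proof -
  have "syllable_value (map_sum A.cls B.cls p) = \<one>\<^bsub>G.P\<^esub>"
    using assms trivial_iff[OF assms(1)] by (cases p) (auto simp del: canon_A_cls canon_B_cls)
  then show ?thesis
    using gval_eq_syllable_value[OF representatives_syllables[OF assms(1)]] by simp
qed

section \<open>The loop and its invariant\<close>

definition invariant :: "('x + 'y) word set \<Rightarrow> ('x, 'y) state \<Rightarrow> bool" where
  "invariant g s \<longleftrightarrow> fst s \<in> words {..<n} \<and> set (fst (snd s)) \<subseteq> syllables \<and>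
     set (snd (snd s)) \<subseteq> S <+> T \<and> (\<forall>p\<in>set (snd (snd s)). \<not> trivial p) \<and>
     successively (\<lambda>p q. isl p \<noteq> isl q) (snd (snd s)) \<and>
     coeff_value (fst s) \<otimes>\<^bsub>G.P\<^esub> gvals (fst (snd s)) \<otimes>\<^bsub>G.P\<^esub> gvals (snd (snd s)) = g"

text \<open>A coefficient split off is multiplied into what remains on its left, so the product is
  unchanged. On alternating input, joining becomes necessary after a deletion, when the last
  remaining syllable belongs to the factor of the head of the tail.\<close>

lemma invariant_step:
  assumes inv: "invariant g (c1, gs, ps)" and "gs \<noteq> []"
  shows "invariant g (step (c1, gs, ps))"
proof -
  obtain c p where sp: "split (last gs) = (c, p)" by fastforce
  obtain c1' gs' where ab: "absorb u v c (c1, butlast gs) = (c1', gs')" by fastforce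
  have c1: "c1 \<in> words {..<n}" and gs: "set gs \<subseteq> syllables" and ps: "set ps \<subseteq> S <+> T"
    "\<forall>p\<in>set ps. \<not> trivial p" "successively (\<lambda>p q. isl p \<noteq> isl q) ps"
    and g: "coeff_value c1 \<otimes>\<^bsub>G.P\<^esub> gvals gs \<otimes>\<^bsub>G.P\<^esub> gvals ps = g"
    using inv by (auto simp: invariant_def)
  have last: "last gs \<in> syllables" and butlast: "set (butlast gs) \<subseteq> syllables"
    using gs \<open>gs \<noteq> []\<close> by (auto dest: in_set_butlastD)
  note s = split_correct[OF last sp]
  note p = representatives_syllables[OF s(2)]
  note a = absorb_correct[OF s(1) c1 butlast ab]
  have pS: "set ps \<subseteq> syllables" using ps(1) representatives_syllables by blast
  have "gvals gs = gvals (butlast gs) \<otimes>\<^bsub>G.P\<^esub> (coeff_value c \<otimes>\<^bsub>G.P\<^esub> gval p)"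
    using gvals_simps(3)[OF last butlast] \<open>gs \<noteq> []\<close> s(4) by simp
  then have g': "coeff_value c1' \<otimes>\<^bsub>G.P\<^esub> gvals gs' \<otimes>\<^bsub>G.P\<^esub> (gval p \<otimes>\<^bsub>G.P\<^esub> gvals ps) = g"
    using g c1 s(1) butlast p pS by (simp add: a(3) values_closed G.m_assoc)
  show ?thesis
  proof (cases "trivial p")
    case True
    then show ?thesis
      using g' a ps trivial_gval[OF s(2)] pS
      by (simp add: invariant_def algorithm_II_step_def sp ab values_closed)
  next
    case nontriv: False
    show ?thesis
    proof (cases ps)
      case Nil
      with nontriv show ?thesis
        using g' a s(2) p
        by (simp add: invariant_def algorithm_II_step_def sp ab gvals_simps)
    next
      case (Cons q qs)
      then have q: "q \<in> syllables" "set qs \<subseteq> syllables" using pS by auto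
      show ?thesis
      proof (cases "join p q")
        case None
        then have "isl p \<noteq> isl q" by (simp add: join_eq_None_iff)
        with None nontriv show ?thesis
          using g' a s(2) p ps pS
          by (simp add: invariant_def algorithm_II_step_def sp ab gvals_simps Cons)
      next
        case (Some pq)
        note j = join_correct[OF p q(1) Some]
        obtain c' p' where sp': "split pq = (c', p')" by fastforce
        obtain c1'' gs'' where ab': "absorb u v c' (c1', gs') = (c1'', gs'')" by fastforce
        note s' = split_correct[OF j(1) sp']
        note p' = representatives_syllables[OF s'(2)]
        note a' = absorb_correct[OF s'(1) a(1,2) ab']
        have "gval p \<otimes>\<^bsub>G.P\<^esub> gvals ps = coeff_value c' \<otimes>\<^bsub>G.P\<^esub> gval p' \<otimes>\<^bsub>G.P\<^esub> gvals qs"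
          using p q by (simp add: Cons gvals_simps values_closed G.m_assoc[symmetric] j(4)[symmetric] s'(4))
        then have g'': "coeff_value c1'' \<otimes>\<^bsub>G.P\<^esub> gvals gs'' \<otimes>\<^bsub>G.P\<^esub> (gval p' \<otimes>\<^bsub>G.P\<^esub> gvals qs) = g"
          using g' a a' s'(1) p' q c1 s(1) butlast by (simp add: values_closed G.m_assoc)
        \<comment> \<open>\<open>p'\<close> has the tag of \<open>q\<close> and may take its place
          before \<open>qs\<close>; if it is deleted, \<open>qs\<close> alternates by
          itself.\<close>
        have qs: "successively (\<lambda>p q. isl p \<noteq> isl q) qs" "successively (\<lambda>p q. isl p \<noteq> isl q) (p' # qs)"
          using ps(3) s'(3) j(2) by (auto simp: Cons successively_Cons)
        show ?thesis
        proof (cases "trivial p'")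
          case True
          with nontriv show ?thesis
            using g'' a' ps qs q trivial_gval[OF s'(2)]
            by (simp add: invariant_def algorithm_II_step_def sp ab Cons Some sp' ab' values_closed)
        next
          case False
          with nontriv show ?thesis
            using g'' a' ps qs(2) q s'(2) p'
            by (simp add: invariant_def algorithm_II_step_def sp ab Cons Some sp' ab' gvals_simps)
        qed
      qed
    qed
  qed
qed

text \<open>\<open>absorb\<close> alters the last remaining syllable or the coefficient but adds no
  syllable, so the one dropped by \<open>butlast\<close> is a net loss.\<close>

lemma step_decreases:
  assumes "gs \<noteq> []"
  shows "length (fst (snd (step (c1, gs, ps)))) < length gs"
proof -
  have "length (snd (absorb u v c d)) = length (snd d)" for c d
    by (auto simp: absorb_def split: prod.split)
  then show ?thesis
    using assms
    by (auto simp: algorithm_II_step_def Let_def case_prod_unfold split: list.split option.split)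
qed

text \<open>The elements of the folded list are ignored; the list is a clock. Its length is the
  initial value of the decreasing measure, hence a sufficient number of rounds.\<close>

definition run :: "('x, 'y) syllable list \<Rightarrow> ('x, 'y) state" where
  "run gs = foldl (\<lambda>s _. if fst (snd s) = [] then s else step s) ([], gs, []) gs"

lemma run:
  "while_option (\<lambda>(_, gs', _). gs' \<noteq> []) step ([], gs, []) = Some (run gs)"
proof -
  have "(\<lambda>s. if (\<lambda>(_, gs', _). gs' \<noteq> []) s then step s else s) = (\<lambda>s. if fst (snd s) = [] then s else step s)"
    by (auto simp: fun_eq_iff)
  then have "run gs = ((\<lambda>s. if (\<lambda>(_, gs', _). gs' \<noteq> []) s then step s else s) ^^ length gs) ([], gs, [])"
    by (simp add: run_def foldl_ignore)
  then show ?thesis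
    using while_option_funpow[of "\<lambda>(_, gs', _). gs' \<noteq> []" "\<lambda>s. length (fst (snd s))" step "([], gs, [])" "length gs"]
      step_decreases by auto
qed

lemma algorithm_II_run:
  "algorithm_II mA rA mB rB u v gs = Some (fst (run gs), snd (snd (run gs)))"
  by (cases "run gs") (simp add: algorithm_II_def run)

lemma run_correct:
  assumes "set gs \<subseteq> syllables"
  shows "invariant (gvals gs) (run gs)" "fst (snd (run gs)) = []"
proof -
  have "invariant (gvals gs) ([], gs, [])"
    using assms by (simp add: invariant_def values_closed gvals_simps G.one_eq[symmetric])
  then show "invariant (gvals gs) (run gs)"
    using while_option_rule[OF _ run, of "invariant (gvals gs)"] invariant_step by fastforce
  show "fst (snd (run gs)) = []"
    using while_option_stop[OF run[of gs]] by (simp add: case_prod_unfold)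
qed

lemma algorithm_II_correct:
  assumes "set gs \<subseteq> syllables"
  obtains c ps where "algorithm_II mA rA mB rB u v gs = Some (c, ps)"
    "c \<in> words {..<n}" "set ps \<subseteq> S <+> T"
    "is_normal_form G.P (\<iota>A ` carrier A.P) (\<iota>B ` carrier B.P) (\<iota>A ` \<phi> ` carrier C)
       (\<iota>A ` A.cls ` S) (\<iota>B ` B.cls ` T) (gvals gs) (coeff_value c, map (\<lambda>p. gval p) ps)"
proof -
  obtain c ps where cps: "run gs = (c, [], ps)"
    using run_correct(2)[OF assms] by (metis prod.collapse)
  note inv = run_correct(1)[OF assms, unfolded cps]
  then have c: "c \<in> words {..<n}" and ps: "set ps \<subseteq> S <+> T"
    "\<forall>p\<in>set ps. \<not> trivial p" "successively (\<lambda>p q. isl p \<noteq> isl q) ps"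
    by (auto simp: invariant_def)
  have g: "coeff_value c \<otimes>\<^bsub>G.P\<^esub> gvals ps = gvals gs"
    using inv values_closed(1)[OF c] by (simp add: invariant_def gvals_simps)
  have pS: "set ps \<subseteq> syllables" using ps(1) representatives_syllables by blast
  let ?ps = "map (map_sum A.cls B.cls) ps"
  \<comment> \<open>The negative triviality tests place the classes of the words in
    \<open>ps\<close> in \<open>N\<close>.\<close>
  have "(word_value c, ?ps) \<in> NF"
    using word_value(1)[OF c] ps trivial_iff by (auto simp: NF_iff successively_map isl_map_sum)
  note nf = normal_form[OF this]
  have 1: "map syllable_value ?ps = map (\<lambda>p. gval p) ps"
    using pS gval_eq_syllable_value by auto
  have "foldr (\<otimes>\<^bsub>G.P\<^esub>) (map (\<lambda>p. gval p) ps) \<one>\<^bsub>G.P\<^esub> = gvals ps"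
    using pS by (induction ps) (auto simp: gvals_simps)
  then have "expression_value (word_value c, ?ps) = gvals gs"
    unfolding expression_value_def snd_conv fst_conv 1 using coeff_value(1)[OF c] g by simp
  with nf 1 coeff_value(1)[OF c] show thesis
    using that[of c ps] c ps(1) by (simp add: algorithm_II_run cps del: map_map)
qed

end


section \<open>Computability of the algorithm\<close>

lemma word_code_eq: "word_code X = list_code (pair_code (to_nat_on X) of_bool)"
  by (simp add: fun_eq_iff word_code_def list_code_def pair_code_def)

lemma syl_code_eq: "syl_code X Y = sum_code (word_code X) (word_code Y)"
  by (simp add: fun_eq_iff syl_code_def sum_code_def)

lemma syls_code_eq: "syls_code X Y = list_code (syl_code X Y)"
  by (simp add: fun_eq_iff syls_code_def list_code_def)

lemma output_code_eq: "output_code X Y n = pair_code (word_code {..<n}) (syls_code X Y)"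
  by (simp add: fun_eq_iff output_code_def pair_code_def)

text \<open>With finitely many letters any operation on them is a finite table; this covers
  replacing a letter by u_i or its inverse.\<close>

lemma computable_on_letters:
  assumes "finite X"
  shows "computable_on (X \<times> UNIV) (pair_code (to_nat_on X) of_bool) e h"
proof (rule computable_on_finite)
  show "finite (X \<times> (UNIV :: bool set))"
    using assms by simp
  show "inj_on (pair_code (to_nat_on X) of_bool) (X \<times> (UNIV :: bool set))"
    using inj_on_to_nat_on[OF countable_finite[OF assms]]
    by (auto simp: inj_on_def pair_code_def of_bool_eq_iff)
qed

lemma set_word: "w \<in> words X \<Longrightarrow> set w \<subseteq> X \<times> UNIV"
  by (auto simp: words_def)

lemma computable_on_concat_letters:
  assumes "finite X" "computable_on D e (word_code X) f" "\<And>x. x \<in> D \<Longrightarrow> f x \<in> words X"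
  shows "computable_on D e (list_code e') (\<lambda>x. concat (map k (f x)))"
  by (rule computable_on_concat_map[OF computable_on_letters[OF assms(1)]])
    (use assms(2,3) set_word in \<open>auto simp: word_code_eq\<close>)

lemma computable_on_inv_word:
  assumes "finite X" "computable_on D e (word_code X) f" "\<And>x. x \<in> D \<Longrightarrow> f x \<in> words X"
  shows "computable_on D e (word_code X) (\<lambda>x. inv_word (f x))"
proof -
  \<comment> \<open>Singleton lists give a letterwise form to which the closure lemma for
    \<open>concat\<close> applies.\<close>
  have eq: "inv_word w = rev (concat (map (\<lambda>(x, e). [(x, \<not> e)]) w))" for w :: "'a word"
    by (induction w) auto
  show ?thesis
    unfolding eq word_code_eq[of X] by (rule computable_on_rev[OF computable_on_concat_letters[OF assms]])
qed

lemma computable_on_subst_word: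
  fixes n :: nat
  assumes "computable_on D e (word_code {..<n}) f" "\<And>x. x \<in> D \<Longrightarrow> f x \<in> words {..<n}"
  shows "computable_on D e (word_code X) (\<lambda>x. subst_word u (f x))"
  unfolding subst_word_def word_code_eq[of X]
  by (rule computable_on_concat_letters[OF finite_lessThan assms])

lemma computable_on_word_append:
  assumes "computable_on D e (word_code X) f" "computable_on D e (word_code X) g"
  shows "computable_on D e (word_code X) (\<lambda>x. f x @ g x)"
  using assms unfolding word_code_eq by (rule computable_on_append)

context search_algorithms
begin

abbreviation "wcode \<equiv> word_code {..<n}"
abbreviation "scode \<equiv> syl_code X Y"

lemma computable_on_split_factor:
  assumes "finite Z" and m: "computable_on (words Z) (word_code Z) (option_code wcode) m"
    and r: "computable_on (words Z) (word_code Z) (word_code Z) r"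
    and rw: "\<And>w. w \<in> words Z \<Longrightarrow> r w \<in> words Z"
    and Some: "\<And>w. w \<in> words Z \<Longrightarrow> m (w @ inv_word (r w)) \<noteq> None"
  shows "computable_on (words Z) (word_code Z) wcode (\<lambda>w. the (m (w @ inv_word (r w))))"
proof (rule computable_on_the)
  have "computable_on (words Z) (word_code Z) (word_code Z) (\<lambda>w. w @ inv_word (r w))"
    by (intro computable_on_word_append computable_on_id computable_on_inv_word[OF assms(1) r] rw)
  then show "computable_on (words Z) (word_code Z) (option_code wcode) (\<lambda>w. m (w @ inv_word (r w)))"
    by (rule computable_on_comp[OF m]) (simp add: rw)
qed (rule Some)

lemma computable_on_split:
  assumes "computable_on D e scode f" "\<And>x. x \<in> D \<Longrightarrow> f x \<in> syllables"
  shows "computable_on D e (pair_code wcode scode) (\<lambda>x. split (f x))"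
proof -
  have A: "computable_on (words X) (word_code X) (pair_code wcode scode) (\<lambda>w. split (Inl w))"
  proof -
    have "rA w \<in> words X" if "w \<in> words X" for w
      using rA S_words that by (auto simp: solves_coset_rep_search_def)
    moreover have "mA (w @ inv_word (rA w)) \<noteq> None" if "w \<in> words X" for w
      using A.search_decomposition[OF mA rA FA.image_subgroup S_words that] by (metis option.distinct(1))
    moreover have r: "computable_on (words X) (word_code X) (word_code X) rA"
      and "computable_on (words X) (word_code X) (option_code wcode) mA"
      using mA rA by (auto simp: solves_membership_search_def solves_coset_rep_search_def)
    ultimately have "computable_on (words X) (word_code X) wcode (\<lambda>w. the (mA (w @ inv_word (rA w))))"
      by (intro computable_on_split_factor finite_X)
    then show ?thesis
      unfolding split_syl.simps syl_code_eq by (intro computable_on_Pair computable_on_Inl r)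
  qed
  have B: "computable_on (words Y) (word_code Y) (pair_code wcode scode) (\<lambda>w. split (Inr w))"
  proof -
    have "rB w \<in> words Y" if "w \<in> words Y" for w
      using rB T_words that by (auto simp: solves_coset_rep_search_def)
    moreover have "mB (w @ inv_word (rB w)) \<noteq> None" if "w \<in> words Y" for w
      using B.search_decomposition[OF mB rB FB.image_subgroup T_words that] by (metis option.distinct(1))
    moreover have r: "computable_on (words Y) (word_code Y) (word_code Y) rB"
      and "computable_on (words Y) (word_code Y) (option_code wcode) mB"
      using mB rB by (auto simp: solves_membership_search_def solves_coset_rep_search_def)
    ultimately have "computable_on (words Y) (word_code Y) wcode (\<lambda>w. the (mB (w @ inv_word (rB w))))"
      by (intro computable_on_split_factor finite_Y)
    then show ?thesis
      unfolding split_syl.simps syl_code_eq by (intro computable_on_Pair computable_on_Inr r)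
  qed
  have f: "computable_on D e (sum_code (word_code X) (word_code Y)) f"
    using assms(1) by (simp add: syl_code_eq)
  note subset = computable_on_subset[OF f]
  have "computable_on D e (pair_code wcode scode) (\<lambda>x. case f x of Inl w \<Rightarrow> split (Inl w) | Inr w \<Rightarrow> split (Inr w))"
  proof (rule computable_on_case_sum[OF f])
    show "computable_on {x \<in> D. isl (f x)} e (pair_code wcode scode) (\<lambda>x. split (Inl (projl (f x))))"
      by (rule computable_on_comp[OF A computable_on_projl[OF subset]])
        (use assms(2) in \<open>force simp: syllables_def\<close>)+
    show "computable_on {x \<in> D. \<not> isl (f x)} e (pair_code wcode scode) (\<lambda>x. split (Inr (projr (f x))))"
      by (rule computable_on_comp[OF B computable_on_projr[OF subset]])
        (use assms(2) in \<open>force simp: syllables_def\<close>)+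
  qed
  then show ?thesis
    by (rule computable_on_cong) (simp split: sum.split)
qed

lemma computable_on_trivial:
  assumes "computable_on D e scode f" "\<And>x. x \<in> D \<Longrightarrow> f x \<in> syllables"
  shows "computable_on D e of_bool (\<lambda>x. trivial (f x))"
proof -
  have A: "computable_on (words X) (word_code X) of_bool (\<lambda>w. trivial (Inl w))"
    using mA unfolding trivial_rep.simps solves_membership_search_def
    by (intro computable_on_is_Some) blast
  have B: "computable_on (words Y) (word_code Y) of_bool (\<lambda>w. trivial (Inr w))"
    using mB unfolding trivial_rep.simps solves_membership_search_def
    by (intro computable_on_is_Some) blast
  have f: "computable_on D e (sum_code (word_code X) (word_code Y)) f"
    using assms(1) by (simp add: syl_code_eq)
  note subset = computable_on_subset[OF f]
  have "computable_on D e of_bool (\<lambda>x. case f x of Inl w \<Rightarrow> trivial (Inl w) | Inr w \<Rightarrow> trivial (Inr w))"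
  proof (rule computable_on_case_sum[OF f])
    show "computable_on {x \<in> D. isl (f x)} e of_bool (\<lambda>x. trivial (Inl (projl (f x))))"
      by (rule computable_on_comp[OF A computable_on_projl[OF subset]])
        (use assms(2) in \<open>force simp: syllables_def\<close>)+
    show "computable_on {x \<in> D. \<not> isl (f x)} e of_bool (\<lambda>x. trivial (Inr (projr (f x))))"
      by (rule computable_on_comp[OF B computable_on_projr[OF subset]])
        (use assms(2) in \<open>force simp: syllables_def\<close>)+
  qed
  then show ?thesis
    by (rule computable_on_cong) (simp split: sum.split)
qed

lemma computable_on_absorb:
  assumes c: "computable_on D e wcode c" "\<And>x. x \<in> D \<Longrightarrow> c x \<in> words {..<n}"
    and c1: "computable_on D e wcode c1" and gs: "computable_on D e (list_code scode) gs"
  shows "computable_on D e (pair_code wcode (list_code scode)) (\<lambda>x. absorb u v (c x) (c1 x, gs x))"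
proof -
  let ?D = "{x \<in> D. gs x \<noteq> []}"
  have gs': "computable_on D' e (list_code scode) gs" if "D' \<subseteq> D" for D'
    using computable_on_subset[OF gs that] .
  have last: "computable_on ?D e (sum_code (word_code X) (word_code Y)) (\<lambda>x. last (gs x))"
    unfolding syl_code_eq[symmetric] by (rule computable_on_last[OF gs']) auto
  have "computable_on ?D e scode (\<lambda>x. case last (gs x) of Inl w \<Rightarrow> Inl (w @ subst_word u (c x)) |
      Inr w \<Rightarrow> Inr (w @ subst_word v (c x)))"
    unfolding syl_code_eq
    by (intro computable_on_case_sum[OF last] computable_on_Inl computable_on_Inr computable_on_word_append
        computable_on_projl[OF computable_on_subset[OF last]] computable_on_projr[OF computable_on_subset[OF last]]
        computable_on_subst_word[where n = n] computable_on_subset[OF c(1)]) (auto intro: c(2))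
  then have "computable_on ?D e (list_code scode) (\<lambda>x. butlast (gs x) @
      [case last (gs x) of Inl w \<Rightarrow> Inl (w @ subst_word u (c x)) | Inr w \<Rightarrow> Inr (w @ subst_word v (c x))])"
    by (intro computable_on_append computable_on_butlast gs' computable_on_Cons computable_on_const) auto
  moreover have "computable_on {x \<in> D. gs x = []} e wcode (\<lambda>x. c1 x @ c x)"
    by (intro computable_on_word_append computable_on_subset[OF c(1)] computable_on_subset[OF c1]) auto
  moreover have "computable_on ?D e wcode c1"
    by (rule computable_on_subset[OF c1]) auto
  moreover have "computable_on D e of_bool (\<lambda>x. gs x = [])"
    by (intro computable_on_is_Nil[OF gs']) auto
  ultimately show ?thesis
    unfolding absorb_def prod.case
    by (intro computable_on_if computable_on_Pair computable_on_const)
qed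

text \<open>A total version of \<open>join\<close>. Where the tags differ it contains an unspecified
  projection, so its value matters only under the test for equal tags.\<close>

definition glue :: "('x, 'y) syllable \<Rightarrow> ('x, 'y) syllable \<Rightarrow> ('x, 'y) syllable" where
  "glue p q = (case p of Inl a \<Rightarrow> Inl (a @ projl q) | Inr b \<Rightarrow> Inr (b @ projr q))"

lemma join_eq: "join p q = (if isl p = isl q then Some (glue p q) else None)"
  by (cases p; cases q) (auto simp: glue_def)

lemma computable_on_glue:
  assumes p: "computable_on D e scode p" and q: "computable_on D e scode q"
    and "\<And>x. x \<in> D \<Longrightarrow> isl (p x) = isl (q x)"
  shows "computable_on D e scode (\<lambda>x. glue (p x) (q x))"
proof -
  note pq = p[unfolded syl_code_eq] q[unfolded syl_code_eq]
  show ?thesis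
    unfolding glue_def syl_code_eq
    by (intro computable_on_case_sum[OF pq(1)] computable_on_Inl computable_on_Inr computable_on_word_append
        computable_on_projl[OF computable_on_subset[OF pq(1)]] computable_on_projr[OF computable_on_subset[OF pq(1)]]
        computable_on_projl[OF computable_on_subset[OF pq(2)]] computable_on_projr[OF computable_on_subset[OF pq(2)]])
      (auto simp: assms(3))
qed

text \<open>The search procedures are specified only on words over X and Y. The invariant guarantees
  such words for every value g, and \<open>step\<close> preserves it while syllables remain, so this
  set can serve as domain of the iteration.\<close>

definition states :: "('x, 'y) state set" where
  "states = {s. \<exists>g. invariant g s}"

lemma step_states: "s \<in> states \<Longrightarrow> fst (snd s) \<noteq> [] \<Longrightarrow> step s \<in> states"
  using invariant_step by (cases s) (fastforce simp: states_def)

abbreviation "state_code \<equiv> pair_code wcode (pair_code (list_code scode) (list_code scode))"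

lemma step_eq:
  "step s =
    (let sp = split (last (fst (snd s))); p = snd sp; ps = snd (snd s);
         ab = absorb u v (fst sp) (fst s, butlast (fst (snd s)));
         sp' = split (glue p (hd ps)); ab' = absorb u v (fst sp') (fst ab, snd ab)
     in if trivial p then (fst ab, snd ab, ps)
        else if ps = [] then (fst ab, snd ab, [p])
        else if isl p = isl (hd ps)
        then (fst ab', snd ab', if trivial (snd sp') then tl ps else snd sp' # tl ps)
        else (fst ab, snd ab, p # ps))"
  by (cases s; cases "snd (snd s)")
    (simp_all add: algorithm_II_step_def Let_def case_prod_unfold join_eq)

lemma computable_on_step:
  "computable_on {s \<in> states. fst (snd s) \<noteq> []} state_code state_code step"
proof -
  let ?D = "{s \<in> states. fst (snd s) \<noteq> []}"
  have D: "fst s \<in> words {..<n}" "set (fst (snd s)) \<subseteq> syllables" "set (snd (snd s)) \<subseteq> syllables"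
    "fst (snd s) \<noteq> []" if "s \<in> ?D" for s
    using that representatives_syllables by (auto simp: states_def invariant_def)
  have c1: "computable_on ?D state_code wcode fst"
    by (rule computable_on_fst[OF computable_on_id])
  have gs: "computable_on ?D state_code (list_code scode) (\<lambda>s. fst (snd s))"
    using computable_on_fst[OF computable_on_snd[OF computable_on_id]] .
  have ps: "computable_on ?D state_code (list_code scode) (\<lambda>s. snd (snd s))"
    using computable_on_snd[OF computable_on_snd[OF computable_on_id]] .
  define sp where "sp s = split (last (fst (snd s)))" for s :: "('x, 'y) state"
  define ab where "ab s = absorb u v (fst (sp s)) (fst s, butlast (fst (snd s)))" for s
  \<comment> \<open>Only on this part is the second split needed, and only here is its argument sure
    to be a well-formed syllable.\<close>
  define E where "E = {s \<in> ?D. snd (snd s) \<noteq> [] \<and> isl (snd (sp s)) = isl (hd (snd (snd s)))}"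
  define sp' where "sp' s = split (glue (snd (sp s)) (hd (snd (snd s))))" for s
  define ab' where "ab' s = absorb u v (fst (sp' s)) (fst (ab s), snd (ab s))" for s
  have last: "last (fst (snd s)) \<in> syllables" if "s \<in> ?D" for s
    using D(2,4)[OF that] by auto
  have sp_c: "fst (sp s) \<in> words {..<n}" and sp_p: "snd (sp s) \<in> syllables" if "s \<in> ?D" for s
    using split_correct(1,2)[OF last[OF that], of "fst (sp s)" "snd (sp s)"] representatives_syllables
    by (auto simp: sp_def)
  have sp: "computable_on ?D state_code (pair_code wcode scode) sp"
    unfolding sp_def by (intro computable_on_split computable_on_last gs last D(4))
  note c = computable_on_fst[OF sp] and p = computable_on_snd[OF sp]
  have ab: "computable_on ?D state_code (pair_code wcode (list_code scode)) ab"
    using computable_on_absorb[OF c _ c1, of "\<lambda>s. butlast (fst (snd s))"] sp_c computable_on_butlast[OF gs]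
    unfolding ab_def by blast
  note ab1 = computable_on_fst[OF ab] and ab2 = computable_on_snd[OF ab]
  have ED: "E \<subseteq> ?D" by (auto simp: E_def)
  have hd: "hd (snd (snd s)) \<in> syllables" if "s \<in> E" for s
    using that D(3)[of s] by (auto simp: E_def)
  have glue: "glue (snd (sp s)) (hd (snd (snd s))) \<in> syllables" if "s \<in> E" for s
    using join_correct(1)[OF sp_p hd, of s s] that by (auto simp: E_def join_eq)
  have sp'_c: "fst (sp' s) \<in> words {..<n}" and sp'_p: "snd (sp' s) \<in> syllables" if "s \<in> E" for s
    using split_correct(1,2)[OF glue[OF that], of "fst (sp' s)" "snd (sp' s)"] representatives_syllables
    by (auto simp: sp'_def)
  have "computable_on E state_code scode (\<lambda>s. glue (snd (sp s)) (hd (snd (snd s))))"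
    by (intro computable_on_glue computable_on_subset[OF p ED] computable_on_hd[OF computable_on_subset[OF ps ED]])
      (auto simp: E_def)
  then have sp': "computable_on E state_code (pair_code wcode scode) sp'"
    unfolding sp'_def by (rule computable_on_split) (rule glue)
  note c' = computable_on_fst[OF sp'] and p' = computable_on_snd[OF sp']
  have ab': "computable_on E state_code (pair_code wcode (list_code scode)) ab'"
    using computable_on_absorb[OF c' sp'_c computable_on_subset[OF ab1 ED]] computable_on_subset[OF ab2 ED]
    unfolding ab'_def by blast
  note ab1' = computable_on_fst[OF ab'] and ab2' = computable_on_snd[OF ab']
  have step: "step s = (if trivial (snd (sp s)) then (fst (ab s), snd (ab s), snd (snd s))
        else if snd (snd s) = [] then (fst (ab s), snd (ab s), [snd (sp s)])
        else if isl (snd (sp s)) = isl (hd (snd (snd s)))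
        then (fst (ab' s), snd (ab' s), if trivial (snd (sp' s)) then tl (snd (snd s)) else snd (sp' s) # tl (snd (snd s)))
        else (fst (ab s), snd (ab s), snd (sp s) # snd (snd s)))" for s
    unfolding step_eq Let_def sp_def ab_def sp'_def ab'_def ..
  have isl: "computable_on {s \<in> ?D. snd (snd s) \<noteq> []} state_code of_bool (\<lambda>s. isl (snd (sp s)) = isl (hd (snd (snd s))))"
  proof -
    have *: "{s \<in> ?D. snd (snd s) \<noteq> []} \<subseteq> ?D" by auto
    show ?thesis
      using computable_on_subset[OF p *] computable_on_hd[OF computable_on_subset[OF ps *]]
      unfolding syl_code_eq by (intro computable_on_bool_eq computable_on_isl) auto
  qed
  have case3: "computable_on E state_code state_code (\<lambda>s. (fst (ab' s), snd (ab' s),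
      if trivial (snd (sp' s)) then tl (snd (snd s)) else snd (sp' s) # tl (snd (snd s))))"
    by (intro computable_on_Pair ab1' ab2' computable_on_if computable_on_trivial[OF p' sp'_p]
        computable_on_tl computable_on_Cons computable_on_subset[OF p'] computable_on_subset[OF ps])
      (auto simp: E_def)
  have triv: "computable_on ?D state_code of_bool (\<lambda>s. trivial (snd (sp s)))"
    by (rule computable_on_trivial[OF p]) (rule sp_p)
  have "computable_on ?D state_code state_code (\<lambda>s. if trivial (snd (sp s)) then (fst (ab s), snd (ab s), snd (snd s))
        else if snd (snd s) = [] then (fst (ab s), snd (ab s), [snd (sp s)])
        else if isl (snd (sp s)) = isl (hd (snd (snd s)))
        then (fst (ab' s), snd (ab' s), if trivial (snd (sp' s)) then tl (snd (snd s)) else snd (sp' s) # tl (snd (snd s)))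
        else (fst (ab s), snd (ab s), snd (sp s) # snd (snd s)))"
  proof (intro computable_on_if[OF triv] computable_on_if)
    show "computable_on {x \<in> {x \<in> {x \<in> ?D. \<not> trivial (snd (sp x))}. snd (snd x) \<noteq> []}. isl (snd (sp x)) = isl (hd (snd (snd x)))}
      state_code state_code (\<lambda>s. (fst (ab' s), snd (ab' s),
      if trivial (snd (sp' s)) then tl (snd (snd s)) else snd (sp' s) # tl (snd (snd s))))"
      by (rule computable_on_subset[OF case3]) (auto simp: E_def)
    show "computable_on {x \<in> {x \<in> ?D. \<not> trivial (snd (sp x))}. snd (snd x) \<noteq> []} state_code of_bool
      (\<lambda>s. isl (snd (sp s)) = isl (hd (snd (snd s))))"
      by (rule computable_on_subset[OF isl]) auto
    show "computable_on {x \<in> ?D. \<not> trivial (snd (sp x))} state_code of_bool (\<lambda>s. snd (snd s) = [])"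
      by (rule computable_on_is_Nil[OF computable_on_subset[OF ps]]) auto
  qed ((intro computable_on_Pair computable_on_Cons computable_on_const
        computable_on_subset[OF ab1] computable_on_subset[OF ab2] computable_on_subset[OF p] computable_on_subset[OF ps]; auto)+)
  then show ?thesis
    by (simp add: step[symmetric])
qed

lemma computable_on_algorithm_II:
  "computable_on {gs. set gs \<subseteq> syllables} (syls_code X Y) (output_code X Y n)
     (\<lambda>gs. the (algorithm_II mA rA mB rB u v gs))"
proof -
  \<comment> \<open>The second argument, an element of the clock list, is ignored; hence
    \<open>UNIV\<close> as its range below.\<close>
  let ?h = "\<lambda>s (_ :: ('x, 'y) syllable). if fst (snd s) = [] then s else step s"
  have "computable_on (states \<times> (UNIV :: ('x, 'y) syllable set)) (pair_code state_code scode) state_code (\<lambda>x. fst x)"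
    by (rule computable_on_fst[OF computable_on_id])
  note fst = computable_on_subset[OF this]
  have "computable_on (states \<times> (UNIV :: ('x, 'y) syllable set)) (pair_code state_code scode) state_code
      (\<lambda>x. if fst (snd (fst x)) = [] then fst x else step (fst x))"
  proof (rule computable_on_if)
    show "computable_on (states \<times> (UNIV :: ('x, 'y) syllable set)) (pair_code state_code scode) of_bool
        (\<lambda>x. fst (snd (fst x)) = [])"
      by (rule computable_on_is_Nil[OF computable_on_fst[OF computable_on_snd[OF fst[OF subset_refl]]]])
    show "computable_on {x \<in> states \<times> (UNIV :: ('x, 'y) syllable set). fst (snd (fst x)) \<noteq> []}
        (pair_code state_code scode) state_code (\<lambda>x. step (fst x))"
      by (rule computable_on_comp[OF computable_on_step fst]) auto
  qed (rule fst, auto)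
  then have "computable_on {gs. set gs \<subseteq> syllables} (list_code scode) state_code (\<lambda>gs. foldl ?h ([], gs, []) gs)"
  proof (rule computable_on_foldl[unfolded case_prod_unfold])
    show "computable_on {gs. set gs \<subseteq> syllables} (list_code scode) state_code (\<lambda>gs. ([], gs, []))"
      by (intro computable_on_Pair computable_on_id computable_on_const)
    \<comment> \<open>The value g demanded by the invariant is taken to be that of the initial state
      itself.\<close>
    show "([], gs, []) \<in> states" if "gs \<in> {gs. set gs \<subseteq> syllables}" for gs
      using that by (auto simp: states_def invariant_def)
    show "computable_on {gs. set gs \<subseteq> syllables} (list_code scode) (list_code scode) (\<lambda>gs. gs)"
      by (rule computable_on_id)
  qed (auto simp: step_states)
  then have run: "computable_on {gs. set gs \<subseteq> syllables} (list_code scode) state_code run"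
    by (simp add: run_def[abs_def])
  have "computable_on {gs. set gs \<subseteq> syllables} (syls_code X Y) (output_code X Y n)
     (\<lambda>gs. (fst (run gs), snd (snd (run gs))))"
    unfolding output_code_eq syls_code_eq
    by (intro computable_on_Pair computable_on_fst[OF run] computable_on_snd[OF computable_on_snd[OF run]])
  then show ?thesis
    by (simp add: algorithm_II_run)
qed

end


theorem theorem3p2:
  fixes X :: "'x set" and RA :: "'x word set"
    and Y :: "'y set" and RB :: "'y word set"
    and C :: "('c, 'm) monoid_scheme" and n :: nat and z :: "nat \<Rightarrow> 'c"
    and \<phi> :: "'c \<Rightarrow> 'x word set" and \<psi> :: "'c \<Rightarrow> 'y word set"
    and u :: "nat \<Rightarrow> 'x word" and v :: "nat \<Rightarrow> 'y word"
    and S :: "'x word set" and T :: "'y word set"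
    and mA :: "'x word \<Rightarrow> nat word option" and rA :: "'x word \<Rightarrow> 'x word"
    and mB :: "'y word \<Rightarrow> nat word option" and rB :: "'y word \<Rightarrow> 'y word"
  defines "A \<equiv> presented_group X RA"
    and "B \<equiv> presented_group Y RB"
    and "G \<equiv> amalgam X RA Y RB n u v"
    and "clsG \<equiv> amalgam_class X RA Y RB n u v"
    and "\<iota>A \<equiv> canon_A X RA Y RB n u v"
    and "\<iota>B \<equiv> canon_B X RA Y RB n u v"
  assumes "finite X" "finite RA" "RA \<subseteq> words X"
    and "finite Y" "finite RB" "RB \<subseteq> words Y"
    and "group C" "z ` {..<n} \<subseteq> carrier C" "carrier C = generate C (z ` {..<n})"
    and "\<phi> \<in> mon C A" "\<psi> \<in> mon C B"
    and "\<And>i. i < n \<Longrightarrow> u i \<in> words X \<and> pres_class X RA (u i) = \<phi> (z i)"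
    and "\<And>i. i < n \<Longrightarrow> v i \<in> words Y \<and> pres_class Y RB (v i) = \<psi> (z i)"
    and "recursive_subset (words X) (word_code X) S"
    and "right_transversal A (\<phi> ` carrier C) (pres_class X RA ` S)"
    and "recursive_subset (words Y) (word_code Y) T"
    and "right_transversal B (\<psi> ` carrier C) (pres_class Y RB ` T)"
    and "solves_membership_search X RA (\<phi> ` carrier C) n u mA"
    and "solves_coset_rep_search X RA (\<phi> ` carrier C) S rA"
    and "solves_membership_search Y RB (\<psi> ` carrier C) n v mB"
    and "solves_coset_rep_search Y RB (\<psi> ` carrier C) T rB"
  shows "(\<forall>g \<in> carrier G. \<forall>gs \<in> input_words X Y. clsG (concat (map syl_word gs)) = g \<longrightarrow>
            (\<exists>c ps. algorithm_II mA rA mB rB u v gs = Some (c, ps) \<and>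
               c \<in> words {..<n} \<and> set ps \<subseteq> S <+> T \<and>
               is_normal_form G (\<iota>A ` carrier A) (\<iota>B ` carrier B) (\<iota>A ` \<phi> ` carrier C)
                 (\<iota>A ` pres_class X RA ` S) (\<iota>B ` pres_class Y RB ` T) g
                 (clsG (map (apfst Inl) (subst_word u c)), map (clsG \<circ> syl_word) ps)))
       \<and> computable_on (input_words X Y) (syls_code X Y) (output_code X Y n)
            (\<lambda>gs. the (algorithm_II mA rA mB rB u v gs))"
proof -
  have ST: "S \<subseteq> words X" "T \<subseteq> words Y"
    using assms by (auto simp: recursive_subset_def)
  interpret search_algorithms X RA Y RB C n z \<phi> \<psi> u v S T mA rA mB rB
    by (intro search_algorithms.intro amalgam_presentation.intro search_algorithms_axioms.intro)
      (fact assms[unfolded A_def B_def] ST)+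
  have inputs: "input_words X Y \<subseteq> {gs. set gs \<subseteq> syllables}"
    by (fastforce simp: input_words_def syllables_def)
  have G: "G = G.P" "clsG = G.cls"
    by (simp_all add: G_def clsG_def amalgam_def amalgam_class_def)
  show ?thesis
  proof (intro conjI ballI impI)
    fix g gs assume "gs \<in> input_words X Y" and g: "clsG (concat (map syl_word gs)) = g"
    then have gs: "set gs \<subseteq> syllables" using inputs by blast
    have "gvals gs = g" using g by (simp add: gvals_def G)
    then show "\<exists>c ps. algorithm_II mA rA mB rB u v gs = Some (c, ps) \<and>
               c \<in> words {..<n} \<and> set ps \<subseteq> S <+> T \<and>
               is_normal_form G (\<iota>A ` carrier A) (\<iota>B ` carrier B) (\<iota>A ` \<phi> ` carrier C)
                 (\<iota>A ` pres_class X RA ` S) (\<iota>B ` pres_class Y RB ` T) g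
                 (clsG (map (apfst Inl) (subst_word u c)), map (clsG \<circ> syl_word) ps)"
      using algorithm_II_correct[OF gs] unfolding G A_def B_def \<iota>A_def \<iota>B_def comp_def by metis
  next
    show "computable_on (input_words X Y) (syls_code X Y) (output_code X Y n)
      (\<lambda>gs. the (algorithm_II mA rA mB rB u v gs))"
      by (rule computable_on_subset[OF computable_on_algorithm_II inputs])
  qed
qed

end
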